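(* Let $BQO \subseteq \mathcal{C}$ be the set of all codes of better quasi-orderings on $\mathbb{N}$, i.e. the set of those $R \in 2^{\mathbb{N}\times\mathbb{N}} \cong \mathcal{C}$ which are quasi-orderings of $\mathbb{N}$ and are bqo. Then $BQO$ is a $\Pi^1_2$-complete subset of $\mathcal{C}$.
   Context: $\mathcal{C}=2^\omega$ is the Cantor space and $\mathcal{N}=\mathbb{N}^\omega$ the Baire space (product topologies of discrete spaces); a binary relation on $\mathbb{N}$ is coded by its characteristic function in $2^{\mathbb{N}\times\mathbb{N}}$, identified with $\mathcal{C}$ via a fixed bijection $\mathbb{N}\times\mathbb{N}\to\mathbb{N}$. A set $C\subseteq \mathcal{X}$ ($\mathcal{X}$ Polish) is $\Pi^1_2$-complete if it is $\Pi^1_2$ and for every $\Pi^1_2$ set $P\subseteq\mathcal{N}$ there is a continuous $f:\mathcal{N}\to\mathcal{X}$ with $x\in P \iff f(x)\in C$ for all $x\in\mathcal N$. For $A\subseteq\mathbb{N}$ infinite, $[A]^\omega$ denotes the set of infinite subsets of $A$, each identified with its increasing enumeration, so $[A]^\omega$ is a (closed) subspace of $\mathcal{N}$ with the induced topology; basic open sets are $N_s=\{X\in[A]^\omega : s\sqsubset X\}$ for finite $s\subseteq A$ (viewed as increasing finite sequences), where $s\sqsubset X$ means $s$ is a proper initial segment of $X$. For nonempty $X\subseteq\mathbb{N}$, $X^-$ is $X$ with its least element removed. For a set $Q$ (discrete topology) and a binary relation $R$ on $Q$, a $Q$-array is a Borel measurable $f:[A]^\omega\to Q$ with $A\subseteq\mathbb{N}$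 infinite; $f$ is good (w.r.t. $R$) if there is $X\in[A]^\omega$ with $f(X)\,R\,f(X^-)$, and bad otherwise. A quasi-ordering (reflexive transitive relation) $(Q,\preceq)$ is bqo if every $Q$-array is good with respect to $\preceq$. *)

theory Defs
  imports "HOL-Analysis.Analysis"
begin

text \<open>
  \<open>nat\<close> and \<open>bool\<close> carry the discrete topology and function types the product topology,
  so \<open>baire\<close> is $\mathbb{N}^\omega$ and \<open>cantor\<close> is $2^\omega$.
\<close>

type_synonym baire = "nat \<Rightarrow> nat"
type_synonym cantor = "nat \<Rightarrow> bool"


section \<open>Projective sets\<close>

text \<open>
  The definitions below are stated for an arbitrary topological space; they have their usual
  meaning when that space is Polish.
\<close>

definition Sigma11 :: "'a::topological_space set \<Rightarrow> bool" where
  "Sigma11 S \<longleftrightarrow> (\<exists>F :: ('a \<times> baire) set. closed F \<and> S = fst ` F)"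

definition Pi11 :: "'a::topological_space set \<Rightarrow> bool" where
  "Pi11 S \<longleftrightarrow> Sigma11 (- S)"

definition Sigma12 :: "'a::topological_space set \<Rightarrow> bool" where
  "Sigma12 S \<longleftrightarrow> (\<exists>B :: ('a \<times> baire) set. Pi11 B \<and> S = fst ` B)"

definition Pi12 :: "'a::topological_space set \<Rightarrow> bool" where
  "Pi12 S \<longleftrightarrow> Sigma12 (- S)"

definition Pi12_complete :: "'a::topological_space set \<Rightarrow> bool" where
  "Pi12_complete C \<longleftrightarrow> Pi12 C \<and>
     (\<forall>P :: baire set. Pi12 P \<longrightarrow>
        (\<exists>f :: baire \<Rightarrow> 'a. continuous_on UNIV f \<and> (\<forall>x. x \<in> P \<longleftrightarrow> f x \<in> C)))"

instance bool :: second_countable_topology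
proof
  show "\<exists>B :: bool set set. countable B \<and> open = generate_topology B"
    by (intro exI[of _ "range lessThan \<union> range greaterThan"]) (auto simp: open_bool_def)
qed

lemma cantor_Polish:
  "completely_metrizable_space (euclidean :: cantor topology)"
  "second_countable (euclidean :: cantor topology)"
proof -
  have "euclidean = (discrete_topology UNIV :: bool topology)"
    by (simp add: topology_eq open_discrete)
  then have "completely_metrizable_space (euclidean :: bool topology)"
    by (simp add: completely_metrizable_space_discrete_topology)
  then have "completely_metrizable_space
      (product_topology (\<lambda>_::nat. euclidean :: bool topology) UNIV)"
    by (subst completely_metrizable_space_product_topology) simp
  then show "completely_metrizable_space (euclidean :: cantor topology)"
    by (simp only: euclidean_product_topology)
  obtain B :: "cantor set set" where B: "countable B" "topological_basis B"
    using ex_countable_basis[where 'a = cantor] by metis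
  have "\<exists>V\<in>B. x \<in> V \<and> V \<subseteq> U" if "open U" "x \<in> U" for U x
    by (metis topological_basisE[OF B(2) that])
  moreover have "open V" if "V \<in> B" for V
    using B(2) that by (rule topological_basis_open)
  ultimately show "second_countable (euclidean :: cantor topology)"
    using B(1) unfolding second_countable_def open_openin[symmetric] by meson
qed


section \<open>Better quasi-orderings\<close>

text \<open>
  $[A]^\omega$: an infinite subset of \<open>A\<close> is represented by its increasing enumeration, an
  element of Baire space.
\<close>

definition inf_subsets :: "nat set \<Rightarrow> baire set" where
  "inf_subsets A = {X. strict_mono X \<and> range X \<subseteq> A}"

lemma bij_betw_inf_subsets:
  "bij_betw range (inf_subsets A) {X. infinite X \<and> X \<subseteq> A}"
proof (rule bij_betw_byWitness[where f' = enumerate])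
  have *: "enumerate (range X) = X" if "strict_mono X" for X :: baire
  proof -
    have inf: "infinite (range X)"
      using that strict_mono_imp_inj_on range_inj_infinite by blast
    have "enumerate (range X) n = X n" for n
    proof (induction n)
      case 0
      show ?case
        unfolding enumerate_0
        using that by (intro Least_equality) (auto simp: strict_mono_less_eq)
    next
      case (Suc n)
      then show ?case
        unfolding enumerate_Suc''[OF inf]
        using that
        by (intro Least_equality) (auto simp: strict_mono_less strict_mono_less_eq Suc_le_eq)
    qed
    then show ?thesis by blast
  qed
  show "\<forall>X \<in> inf_subsets A. enumerate (range X) = X"
    using * by (auto simp: inf_subsets_def)
  show "\<forall>X \<in> {X. infinite X \<and> X \<subseteq> A}. range (enumerate X) = X"
    by (auto simp: range_enumerate)
  show "range ` inf_subsets A \<subseteq> {X. infinite X \<and> X \<subseteq> A}"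
    unfolding inf_subsets_def using strict_mono_imp_inj_on range_inj_infinite by blast
  show "enumerate ` {X. infinite X \<and> X \<subseteq> A} \<subseteq> inf_subsets A"
    using enumerate_in_set by (fastforce simp: inf_subsets_def strict_mono_enumerate)
qed

text \<open>$X^-$: removing the least element of a set shifts its increasing enumeration.\<close>

definition shift :: "baire \<Rightarrow> baire" where
  "shift X = (\<lambda>n. X (Suc n))"

lemma range_shift:
  assumes "strict_mono X"
  shows "range (shift X) = range X - {LEAST n. n \<in> range X}"
proof -
  have "(LEAST n. n \<in> range X) = X 0"
    using assms by (intro Least_equality) (auto simp: strict_mono_less_eq)
  moreover have "range X = insert (X 0) (range (shift X))"
  proof -
    have "X n \<in> insert (X 0) (range (shift X))" for n
      by (cases n) (auto simp: shift_def)
    then show ?thesis by (auto simp: shift_def)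
  qed
  moreover have "X 0 \<notin> range (shift X)"
    using assms by (auto simp: shift_def strict_mono_eq)
  ultimately show ?thesis by auto
qed

text \<open>
  Since \<open>Q\<close> is discrete, every subset of it is Borel; \<open>count_space UNIV\<close> is its Borel space.
  The values of \<open>f\<close> outside \<open>inf_subsets A\<close> are irrelevant.
\<close>

definition array :: "nat set \<Rightarrow> (baire \<Rightarrow> 'q) \<Rightarrow> bool" where
  "array A f \<longleftrightarrow>
     infinite A \<and> f \<in> restrict_space borel (inf_subsets A) \<rightarrow>\<^sub>M count_space UNIV"

definition good :: "('q \<Rightarrow> 'q \<Rightarrow> bool) \<Rightarrow> nat set \<Rightarrow> (baire \<Rightarrow> 'q) \<Rightarrow> bool" where
  "good R A f \<longleftrightarrow> (\<exists>X \<in> inf_subsets A. R (f X) (f (shift X)))"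

definition quasi_order :: "('q \<Rightarrow> 'q \<Rightarrow> bool) \<Rightarrow> bool" where
  "quasi_order R \<longleftrightarrow> reflp R \<and> transp R"

definition bqo :: "('q \<Rightarrow> 'q \<Rightarrow> bool) \<Rightarrow> bool" where
  "bqo R \<longleftrightarrow> quasi_order R \<and> (\<forall>A f. array A f \<longrightarrow> good R A f)"

text \<open>
  The fixed bijection $\mathbb{N}\times\mathbb{N}\to\mathbb{N}$ is \<open>prod_encode\<close>.
\<close>

definition coded_rel :: "cantor \<Rightarrow> nat \<Rightarrow> nat \<Rightarrow> bool" where
  "coded_rel c m n \<longleftrightarrow> c (prod_encode (m, n))"

definition BQO :: "cantor set" where
  "BQO = {c. bqo (coded_rel c)}"

end

theory Submission
  imports Defs
begin

text \<open>
  Upper bound: by the Galvin-Prikry theorem a bad Borel array restricts to a continuous one,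
  which is coded by a real, and badness of the coded array is a \<open>\<Pi>\<^sup>1\<^sub>1\<close> condition.

  Hardness: let the complement of \<open>P\<close> be the set of \<open>x\<close> such that for some \<open>y\<close> the tree
  \<open>T x y\<close> of a closed set has no infinite branch. The order attached to \<open>x\<close> consists of finite
  data \<open>(n, c, u)\<close>, where \<open>u\<close> is an initial part of a guess at \<open>y\<close> and \<open>c\<close> assigns numbers to
  the first nodes of the tree, with \<open>c r \<ge> length r\<close> for every node \<open>r\<close> of \<open>T x u\<close>.
  If \<open>T x y\<close> has no branch, \<open>c r\<close> can be taken to be the height of the part of the tree above
  \<open>r\<close> that is pointwise bounded by \<open>X\<close>; this is finite, and passing from \<open>r\<close> and \<open>X\<close> to a
  child \<open>a # r\<close> with \<open>a \<le> X 0\<close> and to \<open>shift X\<close> does not increase it, which makes the array bad.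
  Conversely, in a bad array one can stabilise the guesses to some \<open>y\<close> and then, column by
  column, enforce \<open>c (z|m+1) (shift X) \<le> c (z|m) X\<close>. Along a branch \<open>z\<close> and a suitable \<open>X\<close>
  this bounds \<open>m \<le> c (z|m)\<close> by the value of \<open>c\<close> at the root, for all \<open>m\<close>: a contradiction.
  The constraint for column \<open>m\<close> is used only at the \<open>m\<close>-th shift of \<open>X\<close>, so that a
  diagonal \<open>X\<close> meets infinitely many of them.
\<close>

section \<open>The Galvin-Prikry theorem\<close>

text \<open>If \<open>B\<close> lies beyond \<open>s\<close>, the sets \<open>s \<union> Y\<close>
  make up the basic neighbourhood [s, B] of the Ellentuck topology.\<close>

definition homogeneous :: "nat set set \<Rightarrow> nat set \<Rightarrow> nat set \<Rightarrow> bool" where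
  "homogeneous S s B \<longleftrightarrow>
     (\<forall>Y\<subseteq>B. infinite Y \<longrightarrow> s \<union> Y \<in> S) \<or> (\<forall>Y\<subseteq>B. infinite Y \<longrightarrow> s \<union> Y \<notin> S)"

definition completely_ramsey :: "nat set set \<Rightarrow> bool" where
  "completely_ramsey S \<longleftrightarrow>
     (\<forall>s A. finite s \<longrightarrow> infinite A \<longrightarrow> (\<exists>B\<subseteq>A. infinite B \<and> homogeneous S s B))"

definition beyond :: "nat set \<Rightarrow> nat set \<Rightarrow> nat set" where
  "beyond s B = {n \<in> B. \<forall>m\<in>s. m < n}"

text \<open>This is openness of the trace of \<open>U\<close> on the infinite sets, in the topology
  inherited from Cantor space.\<close>

definition initially_open :: "nat set set \<Rightarrow> bool" where
  "initially_open U \<longleftrightarrow>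
     (\<forall>Y\<in>U. infinite Y \<longrightarrow> (\<exists>n. \<forall>Z. infinite Z \<longrightarrow> Z \<inter> {..<n} = Y \<inter> {..<n} \<longrightarrow> Z \<in> U))"

section \<open>Shrinking and fusion of infinite sets\<close>

lemma beyond_subset: "beyond s B \<subseteq> B"
  by (auto simp: beyond_def)

lemma infinite_beyond:
  assumes "infinite B" "finite s"
  shows "infinite (beyond s B)"
proof -
  have "B \<subseteq> beyond s B \<union> {..Max (insert 0 s)}"
    using assms by (auto simp: beyond_def not_less) (meson Max_ge finite_insert insertI2 order.trans not_le_imp_less)
  then show ?thesis
    using assms by (metis finite_Un finite_atMost finite_subset)
qed

lemma homogeneous_mono: "homogeneous S s B \<Longrightarrow> B' \<subseteq> B \<Longrightarrow> homogeneous S s B'"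
  unfolding homogeneous_def by (meson order_trans)

lemma simultaneous_shrinking:
  assumes mono: "\<And>s B B'. D s B \<Longrightarrow> B' \<subseteq> B \<Longrightarrow> D s B'"
    and dense: "\<And>s A. s \<in> F \<Longrightarrow> infinite A \<Longrightarrow> \<exists>B\<subseteq>A. infinite B \<and> D s B"
    and "finite F" "infinite (A :: nat set)"
  shows "\<exists>B\<subseteq>A. infinite B \<and> (\<forall>s\<in>F. D s B)"
  using \<open>finite F\<close> dense
proof (induction F rule: finite_induct)
  case empty
  then show ?case using \<open>infinite A\<close> by blast
next
  case (insert t F)
  obtain B where B: "B \<subseteq> A" "infinite B" "\<forall>s\<in>F. D s B"
    using insert.IH insert.prems by (metis insertCI)
  obtain C where C: "C \<subseteq> B" "infinite C" "D t C"
    using insert.prems B(2) by blast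
  then show ?case
    using B mono by (metis insertE order_trans)
qed

text \<open>The sets \<open>C n\<close> decrease, \<open>C (Suc n)\<close> satisfies
  \<open>D\<close> for all subsets of \<open>{..Inf (C n)}\<close>, and \<open>B\<close> consists of
  the minima. A nonempty finite \<open>s \<subseteq> B\<close> has some \<open>b k\<close> as its
  maximum, and then \<open>beyond s B \<subseteq> C (Suc k)\<close>. The empty set is served by
  \<open>C 0\<close>.\<close>

lemma fusion:
  fixes D :: "nat set \<Rightarrow> nat set \<Rightarrow> bool"
  assumes mono: "\<And>s B B'. D s B \<Longrightarrow> B' \<subseteq> B \<Longrightarrow> D s B'"
    and dense: "\<And>s A. finite s \<Longrightarrow> infinite A \<Longrightarrow> \<exists>B\<subseteq>A. infinite B \<and> D s B"
    and A: "infinite A"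
  shows "\<exists>B\<subseteq>A. infinite B \<and> (\<forall>s\<subseteq>B. finite s \<longrightarrow> D s (beyond s B))"
proof -
  have "\<exists>C. \<forall>n. (C n \<subseteq> A \<and> infinite (C n) \<and> (n = 0 \<longrightarrow> D {} (C 0))) \<and>
      (C (Suc n) \<subseteq> beyond {Inf (C n)} (C n) \<and> (\<forall>s\<subseteq>{..Inf (C n)}. D s (C (Suc n))))"
  proof -
    have start: "\<exists>B\<subseteq>A. infinite B \<and> D {} B"
      using dense[OF finite.emptyI A] .
    have step: "\<exists>C'. (C' \<subseteq> A \<and> infinite C') \<and>
        C' \<subseteq> beyond {Inf C} C \<and> (\<forall>s\<subseteq>{..Inf C}. D s C')" if "C \<subseteq> A" "infinite C" for C
    proof -
      have "\<exists>B\<subseteq>beyond {Inf C} C. infinite B \<and> (\<forall>s\<in>Pow {..Inf C}. D s B)"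
      proof (rule simultaneous_shrinking[OF mono])
        show "\<exists>B\<subseteq>A. infinite B \<and> D s B" if "s \<in> Pow {..Inf C}" "infinite A" for s A
          using dense[of s A] that finite_subset by auto
        show "infinite (beyond {Inf C} C)" using infinite_beyond that by simp
      qed auto
      then obtain B where "B \<subseteq> beyond {Inf C} C" "infinite B" "\<forall>s\<in>Pow {..Inf C}. D s B"
        by (elim exE conjE)
      moreover have "beyond {Inf C} C \<subseteq> A" using that(1) beyond_subset by (rule order_trans[rotated])
      ultimately show ?thesis by (intro exI[of _ B]) auto
    qed
    obtain B where B: "B \<subseteq> A" "infinite B" "D {} B" using start by metis
    have "\<exists>C. \<forall>n. (C n \<subseteq> A \<and> infinite (C n) \<and> (n = 0 \<longrightarrow> D {} (C n))) \<and>
      (C (Suc n) \<subseteq> beyond {Inf (C n)} (C n) \<and> (\<forall>s\<subseteq>{..Inf (C n)}. D s (C (Suc n))))"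
      by (rule dependent_nat_choice[where
            P = "\<lambda>n C. C \<subseteq> A \<and> infinite C \<and> (n = 0 \<longrightarrow> D {} C)"])
        (use B step in auto)
    then show ?thesis by simp
  qed
  then obtain C where C: "\<forall>n. (C n \<subseteq> A \<and> infinite (C n) \<and> (n = 0 \<longrightarrow> D {} (C 0))) \<and>
      (C (Suc n) \<subseteq> beyond {Inf (C n)} (C n) \<and> (\<forall>s\<subseteq>{..Inf (C n)}. D s (C (Suc n))))"
    by (elim exE)
  have C0: "D {} (C 0)" using C by blast
  have CA: "C n \<subseteq> A" and Cinf: "infinite (C n)"
    and CS: "C (Suc n) \<subseteq> beyond {Inf (C n)} (C n)" for n
    using C by blast+
  have CD: "D s (C (Suc n))" if "s \<subseteq> {..Inf (C n)}" for n s
    using C that by blast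
  define b where "b n = Inf (C n)" for n
  have Cdec: "C m \<subseteq> C n" if "n \<le> m" for n m
    using lift_Suc_antimono_le[of C, OF _ that] CS beyond_subset by (metis order_trans)
  have bC: "b n \<in> C n" for n
    unfolding b_def using Cinf by (metis Inf_nat_def1 finite.emptyI)
  have bmono: "strict_mono b"
  proof (rule strict_monoI_Suc)
    fix n
    show "b n < b (Suc n)"
      using bC[of "Suc n"] CS[of n] by (auto simp: beyond_def b_def)
  qed
  define B where "B = range b"
  have "infinite B"
    unfolding B_def using bmono strict_mono_imp_inj_on range_inj_infinite by blast
  moreover have "B \<subseteq> A"
    unfolding B_def using bC CA by blast
  moreover have "D s (beyond s B)" if s: "s \<subseteq> B" "finite s" for s
  proof (cases "s = {}")
    case True
    have "beyond s B \<subseteq> C 0"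
      unfolding beyond_def B_def using bC Cdec by blast
    then show ?thesis using C0 mono True by blast
  next
    case False
    then have "Max s \<in> B" using s Max_in by blast
    then obtain k where k: "Max s = b k" by (auto simp: B_def)
    have "s \<subseteq> {..Inf (C k)}"
      using s False k by (metis Max_ge atMost_iff b_def subsetI)
    moreover have "beyond s B \<subseteq> C (Suc k)"
    proof
      fix n assume "n \<in> beyond s B"
      then obtain l where "n = b l" "b k < b l"
        using k False s Max_in[of s] by (auto simp: beyond_def B_def)
      then show "n \<in> C (Suc k)"
        using bC Cdec bmono by (metis Suc_leI in_mono strict_mono_less)
    qed
    ultimately show ?thesis using CD mono by blast
  qed
  ultimately show ?thesis by blast
qed

section \<open>Ramsey's theorem for open sets\<close>

text \<open>Nash-Williams' combinatorial forcing, with \<open>acc\<close> for acceptance and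
  \<open>rej\<close> for rejection of a finite set. If the empty set is not accepted, a second
  fusion yields \<open>C\<close> all of whose finite subsets are rejected, and openness then keeps
  the infinite subsets of \<open>C\<close> out of \<open>U\<close>.\<close>

lemma ramsey_initially_open:
  assumes U: "initially_open U" and A: "infinite A"
  shows "\<exists>B\<subseteq>A. infinite B \<and> homogeneous U {} B"
proof -
  define acc where "acc s B \<longleftrightarrow> (\<forall>Y\<subseteq>B. infinite Y \<longrightarrow> s \<union> Y \<in> U)" for s B
  define rej where "rej s B \<longleftrightarrow> (\<forall>B'\<subseteq>B. infinite B' \<longrightarrow> \<not> acc s B')" for s B
  have accm: "acc s B'" if "acc s B" "B' \<subseteq> B" for s B B'
    using that unfolding acc_def by (meson order_trans)
  have rejm: "rej s B'" if "rej s B" "B' \<subseteq> B" for s B B'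
    using that unfolding rej_def by (meson order_trans)
  have "\<exists>B\<subseteq>A. infinite B \<and> (\<forall>s\<subseteq>B. finite s \<longrightarrow> acc s (beyond s B) \<or> rej s (beyond s B))"
  proof (rule fusion[OF _ _ A])
    show "acc s B' \<or> rej s B'" if "acc s B \<or> rej s B" "B' \<subseteq> B" for s B B'
      using that accm rejm by blast
    show "\<exists>B\<subseteq>A. infinite B \<and> (acc s B \<or> rej s B)" if "infinite A" for s A
      using that unfolding rej_def by blast
  qed
  then obtain B where B: "B \<subseteq> A" "infinite B"
    and "\<forall>s\<subseteq>B. finite s \<longrightarrow> acc s (beyond s B) \<or> rej s (beyond s B)"
    by (elim exE conjE)
  then have dec: "acc s (beyond s B) \<or> rej s (beyond s B)" if "s \<subseteq> B" "finite s" for s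
    using that by simp
  have beyond_empty: "beyond {} B = B" by (simp add: beyond_def)
  show ?thesis
  proof (cases "acc {} B")
    case True
    then show ?thesis using B unfolding acc_def homogeneous_def by auto
  next
    case False
    then have rej0: "rej {} (beyond {} B)" using dec[of "{}"] beyond_empty by auto
    \<comment> \<open>For such \<open>n\<close> the set \<open>insert n s\<close>, being decided, is
      accepted. Infinitely many of them would accept \<open>s\<close>: split the least element off
      \<open>Y\<close>.\<close>
    have fin: "finite {n \<in> beyond s B. \<not> rej (insert n s) (beyond (insert n s) B)}" (is "finite ?N")
      if s: "s \<subseteq> B" "finite s" "rej s (beyond s B)" for s
    proof (rule ccontr)
      assume inf: "infinite ?N"
      have "acc s ?N"
        unfolding acc_def
      proof (intro allI impI)
        fix Y assume Y: "Y \<subseteq> ?N" "infinite Y"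
        define n where "n = Inf Y"
        have n: "n \<in> Y" unfolding n_def using Y(2) by (metis Inf_nat_def1 finite.emptyI)
        have nmin: "n < m" if "m \<in> Y - {n}" for m
          using that unfolding n_def by (metis DiffD1 DiffD2 cInf_lower bdd_below_bot le_neq_implies_less singletonI)
        have "acc (insert n s) (beyond (insert n s) B)"
          using dec[of "insert n s"] Y(1) n s by (auto simp: beyond_def)
        moreover have "Y - {n} \<subseteq> beyond (insert n s) B"
          using Y(1) nmin by (auto simp: beyond_def)
        ultimately have "insert n s \<union> (Y - {n}) \<in> U"
          using Y(2) unfolding acc_def by (metis infinite_remove)
        moreover have "insert n s \<union> (Y - {n}) = s \<union> Y" using n by auto
        ultimately show "s \<union> Y \<in> U" by simp
      qed
      moreover have "?N \<subseteq> beyond s B" by auto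
      ultimately show False using s(3) inf unfolding rej_def by simp
    qed
    \<comment> \<open>The second fusion discards the finitely many exceptions given by
      \<open>fin\<close>, so that one-point extensions inside \<open>C\<close> stay
      rejected.\<close>
    define D where "D s C \<longleftrightarrow> (s \<subseteq> B \<longrightarrow> rej s (beyond s B) \<longrightarrow>
        (\<forall>n\<in>C \<inter> beyond s B. rej (insert n s) (beyond (insert n s) B)))" for s C
    have "\<exists>C\<subseteq>B. infinite C \<and> (\<forall>s\<subseteq>C. finite s \<longrightarrow> D s (beyond s C))"
    proof (rule fusion[OF _ _ B(2)])
      show "D s B'" if "D s B" "B' \<subseteq> B" for s B B'
        using that unfolding D_def by blast
      show "\<exists>C\<subseteq>A. infinite C \<and> D s C" if "finite s" "infinite A" for s A
      proof (cases "s \<subseteq> B \<and> rej s (beyond s B)")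
        case True
        then have "infinite (A - {n \<in> beyond s B. \<not> rej (insert n s) (beyond (insert n s) B)})"
          using fin[of s] that by (simp add: Diff_infinite_finite)
        moreover have "D s (A - {n \<in> beyond s B. \<not> rej (insert n s) (beyond (insert n s) B)})"
          unfolding D_def by blast
        ultimately show ?thesis by (meson Diff_subset)
      next
        case False
        then have "D s A" unfolding D_def by blast
        then show ?thesis using that(2) by (meson order_refl)
      qed
    qed
    then obtain C where C: "C \<subseteq> B" "infinite C"
      and "\<forall>s\<subseteq>C. finite s \<longrightarrow> D s (beyond s C)"
      by (elim exE conjE)
    then have CD: "D s (beyond s C)" if "s \<subseteq> C" "finite s" for s
      using that by simp
    have rejC: "s \<subseteq> C \<Longrightarrow> rej s (beyond s B)" if "finite s" for s
      using that
    proof (induction s rule: finite_linorder_max_induct)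
      case empty
      then show ?case using rej0 by simp
    next
      case (insert n s)
      then have "D s (beyond s C)" "rej s (beyond s B)" using CD by auto
      moreover have "n \<in> beyond s C \<inter> beyond s B"
        using insert C(1) by (auto simp: beyond_def)
      ultimately show ?case
        using insert C(1) unfolding D_def by blast
    qed
    have "Y \<notin> U" if Y: "Y \<subseteq> C" "infinite Y" for Y
    proof
      assume "Y \<in> U"
      then obtain n where n: "\<And>Z. infinite Z \<Longrightarrow> Z \<inter> {..<n} = Y \<inter> {..<n} \<Longrightarrow> Z \<in> U"
        using U Y(2) unfolding initially_open_def by blast
      define s where "s = Y \<inter> {..<n}"
      \<comment> \<open>By openness the segment \<open>s\<close> alone forces membership in
        \<open>U\<close>, against its rejection.\<close>
      have "acc s (beyond {..<n} B)"
        unfolding acc_def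
      proof (intro allI impI)
        fix W assume W: "W \<subseteq> beyond {..<n} B" "infinite W"
        have "(s \<union> W) \<inter> {..<n} = Y \<inter> {..<n}"
          using W(1) unfolding s_def beyond_def by fastforce
        then show "s \<union> W \<in> U" using n W(2) by simp
      qed
      moreover have "beyond {..<n} B \<subseteq> beyond s B"
        unfolding beyond_def s_def by auto
      moreover have "infinite (beyond {..<n} B)" using infinite_beyond B(2) by blast
      moreover have "rej s (beyond s B)" using rejC[of s] Y(1) unfolding s_def by auto
      ultimately show False unfolding rej_def by blast
    qed
    then show ?thesis using B C unfolding homogeneous_def by (intro exI[of _ C]) auto
  qed
qed

text \<open>Union with the fixed finite set \<open>s\<close> is continuous, so the previous lemma
  applies to \<open>{Y. s \<union> Y \<in> U}\<close>.\<close>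

lemma completely_ramsey_initially_open:
  assumes U: "initially_open U"
  shows "completely_ramsey U"
  unfolding completely_ramsey_def
proof (intro allI impI)
  fix s A :: "nat set" assume "finite s" "infinite A"
  have "initially_open {Y. s \<union> Y \<in> U}"
    unfolding initially_open_def
  proof (intro ballI impI)
    fix Y assume "Y \<in> {Y. s \<union> Y \<in> U}" "infinite Y"
    then obtain n where n: "\<And>Z. infinite Z \<Longrightarrow> Z \<inter> {..<n} = (s \<union> Y) \<inter> {..<n} \<Longrightarrow> Z \<in> U"
      using U unfolding initially_open_def by (metis finite_Un mem_Collect_eq)
    then show "\<exists>n. \<forall>Z. infinite Z \<longrightarrow> Z \<inter> {..<n} = Y \<inter> {..<n} \<longrightarrow> Z \<in> {Y. s \<union> Y \<in> U}"
      by (intro exI[of _ n]) (metis Int_Un_distrib2 finite_Un mem_Collect_eq)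
  qed
  from ramsey_initially_open[OF this \<open>infinite A\<close>]
  show "\<exists>B\<subseteq>A. infinite B \<and> homogeneous U s B"
    unfolding homogeneous_def by auto
qed

section \<open>Closure under complements and countable unions\<close>

lemma completely_ramsey_Compl: "completely_ramsey S \<Longrightarrow> completely_ramsey (- S)"
  unfolding completely_ramsey_def homogeneous_def by (metis ComplD ComplI)

text \<open>Bounding \<open>j\<close> by \<open>card s\<close> leaves finitely many requirements at
  each stage of the fusion, yet long initial segments reach every \<open>j\<close>.\<close>

lemma fusion_completely_ramsey:
  fixes S :: "nat \<Rightarrow> nat set set"
  assumes S: "\<And>j. completely_ramsey (S j)" and "finite t" "infinite A"
  shows "\<exists>B\<subseteq>A. infinite B \<and>
    (\<forall>s\<subseteq>B. finite s \<longrightarrow> (\<forall>j\<le>card s. homogeneous (S j) (t \<union> s) (beyond s B)))"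
proof (rule fusion[OF _ _ \<open>infinite A\<close>])
  show "\<forall>j\<le>card s. homogeneous (S j) (t \<union> s) B'"
    if "\<forall>j\<le>card s. homogeneous (S j) (t \<union> s) B" "B' \<subseteq> B" for s B B'
    using that homogeneous_mono by blast
  show "\<exists>B\<subseteq>A. infinite B \<and> (\<forall>j\<le>card s. homogeneous (S j) (t \<union> s) B)"
    if "finite s" "infinite A" for s A
  proof -
    have "\<exists>B\<subseteq>A. infinite B \<and> (\<forall>j\<in>{..card s}. homogeneous (S j) (t \<union> s) B)"
    proof (rule simultaneous_shrinking)
      show "\<exists>B\<subseteq>A. infinite B \<and> homogeneous (S j) (t \<union> s) B" if "infinite A" for j A
        using S that \<open>finite s\<close> \<open>finite t\<close> unfolding completely_ramsey_def by blast
    qed (use homogeneous_mono that in auto)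
    then show ?thesis by auto
  qed
qed

lemma infinite_initial_segment:
  fixes Y :: "nat set"
  assumes "infinite Y"
  shows "\<exists>n. j \<le> card (Y \<inter> {..<n})"
proof -
  obtain F where F: "F \<subseteq> Y" "finite F" "card F = j"
    using infinite_arbitrarily_large[OF assms] by metis
  have "F \<subseteq> Y \<inter> {..<Suc (Max (insert 0 F))}"
    using F by (auto simp: less_Suc_eq_le)
  then have "card F \<le> card (Y \<inter> {..<Suc (Max (insert 0 F))})"
    by (intro card_mono) auto
  then show ?thesis using F by blast
qed

lemma tail_beyond: "Y \<subseteq> B \<Longrightarrow> Y - Y \<inter> {..<n} \<subseteq> beyond (Y \<inter> {..<n}) B"
  by (auto simp: beyond_def)

text \<open>After the fusion, for infinite \<open>Y \<subseteq> B\<close>, the set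
  \<open>t \<union> Y\<close> lies in the union exactly when a finite initial segment of
  \<open>Y\<close> already forces it into some \<open>S j\<close>. This condition is open, so the
  open case finishes the proof.\<close>

lemma completely_ramsey_UN:
  fixes S :: "nat \<Rightarrow> nat set set"
  assumes S: "\<And>j. completely_ramsey (S j)"
  shows "completely_ramsey (\<Union>j. S j)"
  unfolding completely_ramsey_def
proof (intro allI impI)
  fix t A :: "nat set" assume "finite t" "infinite A"
  from fusion_completely_ramsey[of S, OF S this] obtain B where B: "B \<subseteq> A" "infinite B"
    and "\<forall>s\<subseteq>B. finite s \<longrightarrow> (\<forall>j\<le>card s. homogeneous (S j) (t \<union> s) (beyond s B))"
    by (elim exE conjE)
  then have h: "homogeneous (S j) (t \<union> s) (beyond s B)"
    if "s \<subseteq> B" "finite s" "j \<le> card s" for s j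
    using that by simp
  define P where "P s \<longleftrightarrow> (\<exists>j\<le>card s. \<forall>W\<subseteq>beyond s B. infinite W \<longrightarrow> t \<union> s \<union> W \<in> S j)" for s
  define U where "U = {Y. \<exists>n. P (Y \<inter> {..<n})}"
  have U: "Y \<in> U \<longleftrightarrow> t \<union> Y \<in> (\<Union>j. S j)" if Y: "Y \<subseteq> B" "infinite Y" for Y
  proof -
    have W: "Y - Y \<inter> {..<n} \<subseteq> beyond (Y \<inter> {..<n}) B" "infinite (Y - Y \<inter> {..<n})"
      "t \<union> Y \<inter> {..<n} \<union> (Y - Y \<inter> {..<n}) = t \<union> Y" for n
      using Y tail_beyond by (simp, simp add: Diff_infinite_finite, blast)
    show ?thesis
    proof
      assume "Y \<in> U"
      then obtain n j where "\<forall>W\<subseteq>beyond (Y \<inter> {..<n}) B. infinite W \<longrightarrow> t \<union> Y \<inter> {..<n} \<union> W \<in> S j"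
        unfolding U_def P_def by blast
      then show "t \<union> Y \<in> (\<Union>j. S j)" using W[of n] by (metis UNIV_I UN_iff)
    next
      assume "t \<union> Y \<in> (\<Union>j. S j)"
      then obtain j where j: "t \<union> Y \<in> S j" by blast
      obtain n where n: "j \<le> card (Y \<inter> {..<n})" using infinite_initial_segment Y(2) by blast
      have "homogeneous (S j) (t \<union> Y \<inter> {..<n}) (beyond (Y \<inter> {..<n}) B)"
        using h[of "Y \<inter> {..<n}" j] n Y(1) by auto
      then have "\<forall>W\<subseteq>beyond (Y \<inter> {..<n}) B. infinite W \<longrightarrow> t \<union> Y \<inter> {..<n} \<union> W \<in> S j"
        unfolding homogeneous_def using W[of n] j by metis
      then show "Y \<in> U" unfolding U_def P_def using n by blast
    qed
  qed
  have "initially_open U"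
    unfolding initially_open_def
  proof (intro ballI impI)
    fix Y assume "Y \<in> U"
    then obtain n where "P (Y \<inter> {..<n})" unfolding U_def by blast
    then have "Z \<in> U" if "Z \<inter> {..<n} = Y \<inter> {..<n}" for Z
      unfolding U_def by (intro CollectI exI[of _ n]) (simp add: that)
    then show "\<exists>n. \<forall>Z. infinite Z \<longrightarrow> Z \<inter> {..<n} = Y \<inter> {..<n} \<longrightarrow> Z \<in> U" by blast
  qed
  from ramsey_initially_open[OF this B(2)] obtain C
    where "C \<subseteq> B" "infinite C" "homogeneous U {} C" by blast
  then have "homogeneous (\<Union>j. S j) t C"
    using U unfolding homogeneous_def by (metis order_trans sup_bot_left)
  then show "\<exists>B\<subseteq>A. infinite B \<and> homogeneous (\<Union> (range S)) t B"
    using \<open>C \<subseteq> B\<close> \<open>infinite C\<close> B by blast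
qed

text \<open>Fusion for the level sets of \<open>g\<close>: an initial segment of \<open>Y\<close>
  with at least \<open>g Y\<close> elements decides whether \<open>g\<close> takes the value
  \<open>g Y\<close>, and \<open>Y\<close> itself shows that the decision is positive.\<close>

lemma locally_constant_on_homogeneous:
  fixes g :: "nat set \<Rightarrow> nat"
  assumes g: "\<And>k. completely_ramsey {Y. infinite Y \<and> g Y = k}" and "infinite A"
  shows "\<exists>B\<subseteq>A. infinite B \<and> (\<forall>Y\<subseteq>B. infinite Y \<longrightarrow>
    (\<exists>n. \<forall>Z\<subseteq>B. infinite Z \<longrightarrow> Z \<inter> {..<n} = Y \<inter> {..<n} \<longrightarrow> g Z = g Y))"
proof -
  from fusion_completely_ramsey[of "\<lambda>j. {Y. infinite Y \<and> g Y = j}", OF g finite.emptyI \<open>infinite A\<close>]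
  obtain B where B: "B \<subseteq> A" "infinite B"
    and "\<forall>s\<subseteq>B. finite s \<longrightarrow>
      (\<forall>j\<le>card s. homogeneous {Y. infinite Y \<and> g Y = j} ({} \<union> s) (beyond s B))"
    by (elim exE conjE)
  then have h: "homogeneous {Y. infinite Y \<and> g Y = j} s (beyond s B)"
    if "s \<subseteq> B" "finite s" "j \<le> card s" for s j
    using that by simp
  have "\<exists>n. \<forall>Z\<subseteq>B. infinite Z \<longrightarrow> Z \<inter> {..<n} = Y \<inter> {..<n} \<longrightarrow> g Z = g Y"
    if Y: "Y \<subseteq> B" "infinite Y" for Y
  proof -
    obtain n where n: "g Y \<le> card (Y \<inter> {..<n})" using infinite_initial_segment Y(2) by blast
    have W: "Z - Z \<inter> {..<n} \<subseteq> beyond (Z \<inter> {..<n}) B" "infinite (Z - Z \<inter> {..<n})"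
      "Z \<inter> {..<n} \<union> (Z - Z \<inter> {..<n}) = Z" if "Z \<subseteq> B" "infinite Z" for Z
      using that tail_beyond by (simp, simp add: Diff_infinite_finite, blast)
    have "homogeneous {Z. infinite Z \<and> g Z = g Y} (Y \<inter> {..<n}) (beyond (Y \<inter> {..<n}) B)"
      using h[of "Y \<inter> {..<n}" "g Y"] n Y(1) by auto
    then have "\<forall>W\<subseteq>beyond (Y \<inter> {..<n}) B. infinite W \<longrightarrow> g (Y \<inter> {..<n} \<union> W) = g Y"
      unfolding homogeneous_def using W[OF Y] Y by (metis (mono_tags, lifting) mem_Collect_eq)
    then show ?thesis using W by metis
  qed
  then show ?thesis using B by blast
qed

section \<open>Continuous arrays\<close>

lemma open_cylinder: "open {Z :: nat \<Rightarrow> 'a::discrete_topology. \<forall>i<n. Z i = X i}"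
proof -
  have "{Z :: nat \<Rightarrow> 'a. \<forall>i<n. Z i = X i} = (\<Inter>i\<in>{..<n}. (\<lambda>Z. Z i) -` {X i})"
    by auto
  moreover have "open \<dots>"
    by (intro open_INT ballI finite_lessThan open_vimage open_discrete continuous_on_product_coordinates)
  ultimately show ?thesis by simp
qed

lemma open_imp_cylinder:
  fixes V :: "(nat \<Rightarrow> 'a::topological_space) set"
  assumes "open V" "x \<in> V"
  shows "\<exists>n. \<forall>z. (\<forall>i<n. z i = x i) \<longrightarrow> z \<in> V"
proof -
  have "openin (product_topology (\<lambda>_. euclidean) UNIV) V"
    using assms(1) by (simp add: open_fun_def)
  from product_topology_open_contains_basis[OF this assms(2)] obtain W
    where W: "x \<in> (\<Pi>\<^sub>E i\<in>UNIV. W i)" "finite {i. W i \<noteq> UNIV}" "(\<Pi>\<^sub>E i\<in>UNIV. W i) \<subseteq> V"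
    by auto
  define n where "n = Suc (Max (insert 0 {i. W i \<noteq> UNIV}))"
  have "z \<in> V" if "\<forall>i<n. z i = x i" for z
  proof -
    have "z i \<in> W i" for i
    proof (cases "W i = UNIV")
      case False
      then have "i < n" unfolding n_def using W(2) by (simp add: less_Suc_eq_le)
      then show ?thesis using that W(1) by (auto simp: PiE_iff)
    qed simp
    then show ?thesis using W(3) by (auto simp: PiE_iff)
  qed
  then show ?thesis by blast
qed

section \<open>Infinite sets and their increasing enumerations\<close>

lemma enumerate_range:
  assumes "strict_mono (X :: baire)"
  shows "enumerate (range X) = X"
proof -
  have X: "X \<in> inf_subsets UNIV" using assms by (simp add: inf_subsets_def)
  then have inf: "infinite (range X)"
    using bij_betw_inf_subsets[of UNIV] unfolding bij_betw_def by blast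
  have "enumerate (range X) \<in> inf_subsets UNIV"
    using strict_mono_enumerate[OF inf] by (simp add: inf_subsets_def)
  moreover have "range (enumerate (range X)) = range X"
    using range_enumerate[OF inf] .
  ultimately show ?thesis
    using X bij_betw_inf_subsets[of UNIV] by (auto simp: bij_betw_def inj_on_def)
qed

lemma infinite_range_strict_mono: "strict_mono (X :: baire) \<Longrightarrow> infinite (range X)"
  using strict_mono_imp_inj_on range_inj_infinite by blast

text \<open>Below \<open>N\<close> both sequences list the same set in order; a mismatch of
  positions would repeat an earlier entry, against injectivity.\<close>

lemma strict_mono_eq_of_range:
  fixes X Z :: baire
  assumes X: "strict_mono X" and Z: "strict_mono Z"
    and eq: "range X \<inter> {..<N} = range Z \<inter> {..<N}" and "X i < N"
  shows "Z i = X i"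
  using \<open>X i < N\<close>
proof (induction i rule: less_induct)
  case (less i)
  have IH: "Z j = X j" if "j < i" for j
    using less that X by (meson less_trans strict_monoD)
  obtain j where j: "X i = Z j"
    using eq less.prems by blast
  show ?case
  proof (cases j i rule: linorder_cases)
    case less
    then have "X j = X i" using IH j by simp
    then show ?thesis using less X by (simp add: strict_mono_eq)
  next
    case equal
    then show ?thesis using j by simp
  next
    case greater
    then have "Z i < X i" using j Z by (simp add: strict_mono_less)
    then obtain k where k: "Z i = X k"
      using eq less.prems by (metis IntD1 IntI imageE lessThan_iff less_trans rangeI)
    then have "k < i" using \<open>Z i < X i\<close> X by (simp add: strict_mono_less)
    then have "Z k = Z i" using IH k by simp
    then show ?thesis using \<open>k < i\<close> Z by (simp add: strict_mono_eq)
  qed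
qed

lemma enumerate_eq_of_initial_segment:
  fixes Y Z :: "nat set"
  assumes Y: "infinite Y" and Z: "infinite Z"
    and eq: "Z \<inter> {..<enumerate Y n} = Y \<inter> {..<enumerate Y n}" and "i < n"
  shows "enumerate Z i = enumerate Y i"
proof (rule strict_mono_eq_of_range[of "enumerate Y" "enumerate Z" "enumerate Y n" i])
  show "enumerate Y i < enumerate Y n"
    using \<open>i < n\<close> Y by (rule enumerate_mono)
  show "range (enumerate Y) \<inter> {..<enumerate Y n} = range (enumerate Z) \<inter> {..<enumerate Y n}"
    using eq Y Z by (simp add: range_enumerate)
qed (use Y Z strict_mono_enumerate in auto)

section \<open>Borel sets are completely Ramsey\<close>

lemma completely_ramsey_cong:
  assumes "completely_ramsey S" "\<And>Y. infinite Y \<Longrightarrow> Y \<in> S \<longleftrightarrow> Y \<in> S'"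
  shows "completely_ramsey S'"
proof -
  have "homogeneous S s B \<Longrightarrow> homogeneous S' s B" for s B
    using assms(2) unfolding homogeneous_def by (metis finite_Un)
  then show ?thesis using assms(1) unfolding completely_ramsey_def by meson
qed

text \<open>Induction over the generated sigma-algebra. Open sets fall under the open case because
  the part of \<open>Y\<close> below \<open>enumerate Y n\<close> fixes its first \<open>n\<close>
  entries.\<close>

lemma completely_ramsey_borel:
  assumes "V \<in> sets (borel :: baire measure)"
  shows "completely_ramsey {Y. infinite Y \<and> enumerate Y \<in> V}"
  using assms unfolding sets_borel
proof (induction V rule: sigma_sets.induct)
  case (Basic V)
  then have V: "open V" by simp
  have "initially_open {Y. infinite Y \<and> enumerate Y \<in> V}"
    unfolding initially_open_def
  proof (intro ballI impI)
    fix Y assume Y: "infinite Y" "Y \<in> {Y. infinite Y \<and> enumerate Y \<in> V}"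
    then obtain n where n: "\<And>z. (\<forall>i<n. z i = enumerate Y i) \<Longrightarrow> z \<in> V"
      using open_imp_cylinder[OF V] by blast
    have "enumerate Z \<in> V" if Z: "infinite Z" "Z \<inter> {..<enumerate Y n} = Y \<inter> {..<enumerate Y n}" for Z
    proof (rule n, intro allI impI)
      fix i assume "i < n"
      then show "enumerate Z i = enumerate Y i"
        using enumerate_eq_of_initial_segment Y(1) Z by blast
    qed
    then show "\<exists>n. \<forall>Z. infinite Z \<longrightarrow> Z \<inter> {..<n} = Y \<inter> {..<n} \<longrightarrow>
        Z \<in> {Y. infinite Y \<and> enumerate Y \<in> V}"
      by blast
  qed
  then show ?case by (rule completely_ramsey_initially_open)
next
  case Empty
  then show ?case unfolding completely_ramsey_def homogeneous_def by auto
next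
  case (Compl V)
  from completely_ramsey_Compl[OF Compl.IH] show ?case
    by (rule completely_ramsey_cong) auto
next
  case (Union V)
  from completely_ramsey_UN[OF Union.IH] show ?case
    by (rule completely_ramsey_cong) auto
qed

text \<open>This is continuity on \<open>inf_subsets UNIV\<close> for discrete values.\<close>

definition locally_constant :: "(baire \<Rightarrow> 'q) \<Rightarrow> bool" where
  "locally_constant f \<longleftrightarrow> (\<forall>X. strict_mono X \<longrightarrow>
     (\<exists>n. \<forall>Z. strict_mono Z \<longrightarrow> (\<forall>i<n. Z i = X i) \<longrightarrow> f Z = f X))"

text \<open>Preimages are traces of unions of cylinders on whose increasing members \<open>f\<close>
  is constant, hence relatively open.\<close>

lemma array_locally_constant:
  assumes "locally_constant f"
  shows "array UNIV f"
proof -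
  have "f -` S \<inter> inf_subsets UNIV \<in> sets (restrict_space borel (inf_subsets UNIV))" for S
  proof -
    define U where "U = \<Union>{{Z. \<forall>i<n. Z i = X i} | X n. strict_mono X \<and> f X \<in> S \<and>
        (\<forall>Z. strict_mono Z \<longrightarrow> (\<forall>i<n. Z i = X i) \<longrightarrow> f Z = f X)}"
    have "open U" unfolding U_def using open_cylinder by (intro open_Union) blast
    moreover have "f -` S \<inter> inf_subsets UNIV = inf_subsets UNIV \<inter> U"
    proof (intro equalityI subsetI)
      fix X assume "X \<in> f -` S \<inter> inf_subsets UNIV"
      then have X: "f X \<in> S" "strict_mono X" by (auto simp: inf_subsets_def)
      then obtain n where "\<forall>Z. strict_mono Z \<longrightarrow> (\<forall>i<n. Z i = X i) \<longrightarrow> f Z = f X"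
        using assms unfolding locally_constant_def by blast
      then have "X \<in> U" unfolding U_def using X by blast
      then show "X \<in> inf_subsets UNIV \<inter> U" using X by (simp add: inf_subsets_def)
    next
      fix X assume X: "X \<in> inf_subsets UNIV \<inter> U"
      then have "strict_mono X" by (simp add: inf_subsets_def)
      obtain Y n where "f Y \<in> S" "\<forall>i<n. X i = Y i"
        "\<forall>Z. strict_mono Z \<longrightarrow> (\<forall>i<n. Z i = Y i) \<longrightarrow> f Z = f Y"
        using X unfolding U_def by blast
      then have "f X \<in> S" using \<open>strict_mono X\<close> by simp
      then show "X \<in> f -` S \<inter> inf_subsets UNIV" using X by simp
    qed
    ultimately show ?thesis unfolding sets_restrict_space by (simp add: imageI)
  qed
  then show ?thesis
    unfolding array_def measurable_def by (simp add: space_restrict_space)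
qed

section \<open>From Borel arrays to continuous ones\<close>

lemma shift_comp: "shift (b \<circ> X) = b \<circ> shift X"
  by (simp add: shift_def fun_eq_iff)

lemma strict_mono_shift: "strict_mono X \<Longrightarrow> strict_mono (shift X)"
  by (simp add: shift_def strict_mono_def)

lemma strict_mono_comp_inf_subsets:
  "strict_mono b \<Longrightarrow> range b \<subseteq> A \<Longrightarrow> strict_mono X \<Longrightarrow> b \<circ> X \<in> inf_subsets A"
  by (auto simp: inf_subsets_def strict_mono_def)

text \<open>Composition with \<open>b\<close> is continuous, so measurability is inherited; this
  moves an array on any \<open>A\<close> to \<open>UNIV\<close>.\<close>

lemma array_reindex:
  assumes f: "array A f" and b: "strict_mono b" "range b \<subseteq> A"
  shows "array UNIV (\<lambda>X. f (b \<circ> X))"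
proof -
  have "continuous_on UNIV (\<lambda>X::baire. b \<circ> X)"
  proof (rule continuous_on_coordinatewise_then_product)
    fix i
    have "continuous_on UNIV (\<lambda>X::baire. b (X i))"
      unfolding continuous_on_open_vimage[OF open_UNIV]
    proof (intro allI impI)
      fix S :: "nat set"
      have "(\<lambda>X::baire. b (X i)) -` S \<inter> UNIV = (\<lambda>X. X i) -` (b -` S)" by auto
      moreover have "open \<dots>"
        by (intro open_vimage open_discrete continuous_on_product_coordinates)
      ultimately show "open ((\<lambda>X::baire. b (X i)) -` S \<inter> UNIV)" by simp
    qed
    then show "continuous_on UNIV (\<lambda>X::baire. (b \<circ> X) i)" by simp
  qed
  then have "(\<lambda>X::baire. b \<circ> X) \<in> borel_measurable borel"
    by (rule borel_measurable_continuous_onI)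
  then have "(\<lambda>X::baire. b \<circ> X) \<in> restrict_space borel (inf_subsets UNIV) \<rightarrow>\<^sub>M
      restrict_space borel (inf_subsets A)"
    by (rule measurable_restrict_space3)
      (use strict_mono_comp_inf_subsets[OF b] in \<open>auto simp: inf_subsets_def\<close>)
  then show ?thesis
    using f unfolding array_def by (auto intro: measurable_compose)
qed

text \<open>Reindexing along \<open>A\<close> gives \<open>h\<close>, whose level sets are
  completely Ramsey. On a suitable \<open>B\<close> it becomes continuous, and reindexing along
  \<open>B\<close> gives \<open>g\<close>. Badness survives because reindexing commutes with
  \<open>shift\<close>.\<close>

lemma continuous_bad_array:
  fixes f :: "baire \<Rightarrow> nat"
  assumes f: "array A f" and bad: "\<not> good R A f"
  shows "\<exists>g. locally_constant g \<and> (\<forall>X. strict_mono X \<longrightarrow> \<not> R (g X) (g (shift X)))"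
proof -
  have "infinite A" using f by (simp add: array_def)
  define a where "a = enumerate A"
  have a: "strict_mono a" "range a \<subseteq> A"
    using \<open>infinite A\<close> by (simp_all add: a_def strict_mono_enumerate range_enumerate)
  define h where "h X = f (a \<circ> X)" for X
  have harr: "array UNIV h" unfolding h_def using array_reindex[OF f a] .
  have hbad: "\<not> R (h X) (h (shift X))" if "strict_mono X" for X
    using bad strict_mono_comp_inf_subsets[OF a that]
    unfolding good_def h_def by (metis shift_comp)
  have "completely_ramsey {Y. infinite Y \<and> h (enumerate Y) = k}" for k
  proof -
    have "h -` {k} \<inter> inf_subsets UNIV \<in> sets (restrict_space borel (inf_subsets UNIV))"
      using harr unfolding array_def by (auto simp: measurable_def space_restrict_space)
    then obtain V where V: "V \<in> sets borel" "h -` {k} \<inter> inf_subsets UNIV = inf_subsets UNIV \<inter> V"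
      unfolding sets_restrict_space by (rule imageE) simp
    have "enumerate Y \<in> V \<longleftrightarrow> h (enumerate Y) = k" if "infinite Y" for Y
      using V(2) strict_mono_enumerate[OF that] unfolding inf_subsets_def by blast
    with completely_ramsey_borel[OF V(1)] show ?thesis
      by (auto elim: completely_ramsey_cong)
  qed
  from locally_constant_on_homogeneous[of "\<lambda>Y. h (enumerate Y)", OF this infinite_UNIV_nat]
  obtain B where "infinite B" and B: "\<forall>Y\<subseteq>B. infinite Y \<longrightarrow>
      (\<exists>n. \<forall>Z\<subseteq>B. infinite Z \<longrightarrow> Z \<inter> {..<n} = Y \<inter> {..<n} \<longrightarrow> h (enumerate Z) = h (enumerate Y))"
    by (elim exE conjE)
  define b where "b = enumerate B"
  have b: "strict_mono b" "range b \<subseteq> B"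
    using \<open>infinite B\<close> by (simp_all add: b_def strict_mono_enumerate range_enumerate)
  define g where "g X = h (b \<circ> X)" for X
  have "locally_constant g"
    unfolding locally_constant_def
  proof (intro allI impI)
    fix X :: baire assume X: "strict_mono X"
    have ran: "range (b \<circ> Z) \<subseteq> B" "infinite (range (b \<circ> Z))" "enumerate (range (b \<circ> Z)) = b \<circ> Z"
      if "strict_mono Z" for Z
    proof -
      have "strict_mono (b \<circ> Z)" "range (b \<circ> Z) \<subseteq> B"
        using strict_mono_comp_inf_subsets[OF b that] by (simp_all only: inf_subsets_def mem_Collect_eq)
      then show "range (b \<circ> Z) \<subseteq> B" "infinite (range (b \<circ> Z))"
        "enumerate (range (b \<circ> Z)) = b \<circ> Z"
        by (blast, blast dest: infinite_range_strict_mono, blast intro: enumerate_range)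
    qed
    obtain n where n: "\<And>Z. Z \<subseteq> B \<Longrightarrow> infinite Z \<Longrightarrow> Z \<inter> {..<n} = range (b \<circ> X) \<inter> {..<n} \<Longrightarrow>
        h (enumerate Z) = h (enumerate (range (b \<circ> X)))"
      using B ran[OF X] by meson
    have "g Z = g X" if Z: "strict_mono Z" "\<forall>i<n. Z i = X i" for Z
    proof -
      \<comment> \<open>An increasing sequence dominates its index, so a value below
        \<open>n\<close> sits at an index below \<open>n\<close>, where the two sequences
        agree.\<close>
      have "(b \<circ> Z') i \<in> range (b \<circ> Z'')"
        if "(b \<circ> Z') i < n" "strict_mono Z'" "\<forall>i<n. Z'' i = Z' i" for Z' Z'' i
      proof -
        have "i \<le> (b \<circ> Z') i"
          using that(2) b(1) by (intro strict_mono_imp_increasing) (auto simp: strict_mono_def)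
        then have "i < n" using that(1) by simp
        then have "(b \<circ> Z') i = (b \<circ> Z'') i" using that(3) by simp
        then show ?thesis by (metis rangeI)
      qed
      from this[of Z _ X] this[of X _ Z]
      have "range (b \<circ> Z) \<inter> {..<n} = range (b \<circ> X) \<inter> {..<n}"
        using X Z by fastforce
      then show ?thesis using n ran[OF Z(1)] ran[OF X] unfolding g_def by metis
    qed
    then show "\<exists>n. \<forall>Z. strict_mono Z \<longrightarrow> (\<forall>i<n. Z i = X i) \<longrightarrow> g Z = g X" by blast
  qed
  moreover have "\<not> R (g X) (g (shift X))" if "strict_mono X" for X
    using hbad[of "b \<circ> X"] that strict_mono_comp_inf_subsets[OF b that]
    unfolding g_def by (simp add: shift_comp inf_subsets_def)
  ultimately show ?thesis by blast
qed

text \<open>This replaces the quantifier over Borel arrays by one over locally constant arrays,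
  which single reals code directly.\<close>

lemma bqo_iff_locally_constant:
  fixes R :: "nat \<Rightarrow> nat \<Rightarrow> bool"
  shows "bqo R \<longleftrightarrow> quasi_order R \<and>
    (\<forall>f. locally_constant f \<longrightarrow> (\<exists>X. strict_mono X \<and> R (f X) (f (shift X))))"
proof -
  have "\<exists>X. strict_mono X \<and> R (f X) (f (shift X))"
    if "\<forall>A f. array A f \<longrightarrow> good R A f" "locally_constant f" for f
  proof -
    have "good R UNIV f" using that array_locally_constant by blast
    then show ?thesis by (auto simp: good_def inf_subsets_def)
  qed
  then show ?thesis
    unfolding bqo_def using continuous_bad_array[of _ _ R] by metis
qed

section \<open>The upper bound\<close>

lemma closed_imp_finitely_refuted:
  fixes F :: "(((nat \<Rightarrow> 'a::topological_space) \<times> (nat \<Rightarrow> 'b::topological_space)) \<times>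
    (nat \<Rightarrow> 'c::topological_space)) set"
  assumes "closed F" "((x, y), z) \<notin> F"
  shows "\<exists>N. \<forall>x' y' z'. (\<forall>i<N. x' i = x i \<and> y' i = y i \<and> z' i = z i) \<longrightarrow> ((x', y'), z') \<notin> F"
proof -
  have "open (- F)" "((x, y), z) \<in> - F" using assms by auto
  then obtain U W where UW: "open U" "open W" "(x, y) \<in> U" "z \<in> W" "U \<times> W \<subseteq> - F"
    by (metis open_prod_elim mem_Sigma_iff)
  then obtain U1 U2 where U: "open U1" "open U2" "x \<in> U1" "y \<in> U2" "U1 \<times> U2 \<subseteq> U"
    by (metis open_prod_elim mem_Sigma_iff)
  obtain n1 n2 n3 where n: "\<And>x'. (\<forall>i<n1. x' i = x i) \<Longrightarrow> x' \<in> U1"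
    "\<And>y'. (\<forall>i<n2. y' i = y i) \<Longrightarrow> y' \<in> U2" "\<And>z'. (\<forall>i<n3. z' i = z i) \<Longrightarrow> z' \<in> W"
    using open_imp_cylinder[OF U(1,3)] open_imp_cylinder[OF U(2,4)] open_imp_cylinder[OF UW(2,4)]
    by metis
  have "((x', y'), z') \<notin> F"
    if "\<forall>i<max n1 (max n2 n3). x' i = x i \<and> y' i = y i \<and> z' i = z i" for x' y' z'
  proof -
    have "x' \<in> U1" "y' \<in> U2" "z' \<in> W"
      by (rule n, use that in simp)+
    then show ?thesis using U(5) UW(5) by blast
  qed
  then show ?thesis by blast
qed

lemma closed_if_finitely_refuted:
  fixes F :: "(((nat \<Rightarrow> 'a::discrete_topology) \<times> (nat \<Rightarrow> 'b::discrete_topology)) \<times>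
    (nat \<Rightarrow> 'c::discrete_topology)) set"
  assumes "\<And>x y z. ((x, y), z) \<notin> F \<Longrightarrow>
    \<exists>N. \<forall>x' y' z'. (\<forall>i<N. x' i = x i \<and> y' i = y i \<and> z' i = z i) \<longrightarrow> ((x', y'), z') \<notin> F"
  shows "closed F"
  unfolding closed_def
proof (subst open_subopen, intro ballI)
  fix p assume "p \<in> - F"
  moreover obtain x y z where p: "p = ((x, y), z)" by (metis surj_pair)
  ultimately obtain N where N: "\<And>x' y' z'. (\<forall>i<N. x' i = x i \<and> y' i = y i \<and> z' i = z i) \<Longrightarrow>
      ((x', y'), z') \<notin> F"
    using assms[of x y z] by auto
  have "open (({x'. \<forall>i<N. x' i = x i} \<times> {y'. \<forall>i<N. y' i = y i}) \<times> {z'. \<forall>i<N. z' i = z i})"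
    by (intro open_Times open_cylinder)
  then show "\<exists>T. open T \<and> p \<in> T \<and> T \<subseteq> - F"
    using N p by (intro exI conjI) (assumption, auto)
qed

definition segment :: "baire \<Rightarrow> nat \<Rightarrow> nat" where
  "segment X n = list_encode (map X [0..<n])"

lemma segment_cong: "(\<And>i. i < n \<Longrightarrow> X i = Y i) \<Longrightarrow> segment X n = segment Y n"
  unfolding segment_def by (metis atLeastLessThan_iff map_cong set_upt)

lemma segment_eq_iff: "segment X n = segment Y n \<longleftrightarrow> (\<forall>i<n. X i = Y i)"
  unfolding segment_def by (auto simp: list_encode_eq list_eq_iff_nth_eq)

lemma length_segment: "length (list_decode (segment X n)) = n"
  by (simp add: segment_def)

text \<open>
  A real \<open>w\<close> codes the continuous array that takes the value \<open>k\<close> at \<open>X\<close> as soon as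
  \<open>w (segment X n) = Suc k\<close> for some \<open>n\<close>. A refutation \<open>v\<close> consists of a set \<open>shift v\<close>
  and of a tag \<open>v 0\<close>, which claims that the array is undefined there or points to
  the two values showing that it is good.
\<close>

definition refutes :: "cantor \<Rightarrow> baire \<Rightarrow> baire \<Rightarrow> bool" where
  "refutes c w v \<longleftrightarrow> quasi_order (coded_rel c) \<and> strict_mono (shift v) \<and>
     (v 0 = 0 \<longrightarrow> (\<forall>n. w (segment (shift v) n) = 0)) \<and>
     (\<forall>n m. v 0 = Suc (prod_encode (n, m)) \<longrightarrow>
        w (segment (shift v) n) \<noteq> 0 \<and> w (segment (shift (shift v)) m) \<noteq> 0 \<and>
        coded_rel c (w (segment (shift v) n) - 1) (w (segment (shift (shift v)) m) - 1))"

lemma not_quasi_order_cases: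
  assumes "\<not> quasi_order (R :: 'a \<Rightarrow> 'a \<Rightarrow> bool)"
  obtains a where "\<not> R a a" | a b d where "R a b" "R b d" "\<not> R a d"
  using assms unfolding quasi_order_def reflp_def transp_def by blast

text \<open>Each clause of \<open>refutes\<close> fails on the evidence of finitely many values of
  \<open>c\<close>, \<open>w\<close> and \<open>v\<close>.\<close>

lemma closed_refutes: "closed {((c, w), v). refutes c w v}"
proof (rule closed_if_finitely_refuted)
  fix c :: cantor and w v :: baire
  let ?ag = "\<lambda>N (c' :: cantor) (w' :: baire) (v' :: baire).
    \<forall>i<N. c' i = c i \<and> w' i = w i \<and> v' i = v i"
  assume "((c, w), v) \<notin> {((c, w), v). refutes c w v}"
  then have neg: "\<not> refutes c w v" by simp
  \<comment> \<open>The first \<open>n\<close> entries of \<open>shift (shift v)\<close> read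
    \<open>v\<close> up to index \<open>n + 1\<close>, whence the bound
    \<open>n + 2\<close>.\<close>
  have seg: "segment (shift v') n = segment (shift v) n \<and>
      segment (shift (shift v')) n = segment (shift (shift v)) n"
    if "?ag N c' w' v'" "n + 2 \<le> N" for N c' w' v' n
    using that by (auto simp: segment_eq_iff shift_def)
  consider (qo) "\<not> quasi_order (coded_rel c)" | (mono) "\<not> strict_mono (shift v)"
    | (undef) n where "v 0 = 0" "w (segment (shift v) n) \<noteq> 0"
    | (val) n m where "v 0 = Suc (prod_encode (n, m))"
      "\<not> (w (segment (shift v) n) \<noteq> 0 \<and> w (segment (shift (shift v)) m) \<noteq> 0 \<and>
        coded_rel c (w (segment (shift v) n) - 1) (w (segment (shift (shift v)) m) - 1))"
    using neg unfolding refutes_def by blast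
  then have "\<exists>N. \<forall>c' w' v'. ?ag N c' w' v' \<longrightarrow> \<not> refutes c' w' v'"
  proof cases
    case qo
    then show ?thesis
    proof (cases rule: not_quasi_order_cases)
      case (1 a)
      have "\<not> quasi_order (coded_rel c')" if "?ag (Suc (prod_encode (a, a))) c' w' v'" for c' w' v'
        using 1 that by (auto simp: quasi_order_def reflp_def coded_rel_def)
      then show ?thesis unfolding refutes_def by metis
    next
      case (2 a b d)
      have "\<not> quasi_order (coded_rel c')"
        if "?ag (Suc (prod_encode (a, b) + prod_encode (b, d) + prod_encode (a, d))) c' w' v'"
        for c' w' v'
      proof -
        have "coded_rel c' a b" "coded_rel c' b d" "\<not> coded_rel c' a d"
          using 2 that by (auto simp: coded_rel_def)
        then show ?thesis unfolding quasi_order_def transp_def by blast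
      qed
      then show ?thesis unfolding refutes_def by metis
    qed
  next
    case mono
    then obtain n where n: "\<not> v (Suc n) < v (Suc (Suc n))"
      by (auto simp: strict_mono_Suc_iff shift_def)
    have "\<not> strict_mono (shift v')" if "?ag (n + 3) c' w' v'" for c' w' v'
      using n that by (auto simp: strict_mono_Suc_iff shift_def intro!: exI[of _ n])
    then show ?thesis unfolding refutes_def by metis
  next
    case (undef n)
    have "v' 0 = 0 \<and> w' (segment (shift v') n) \<noteq> 0"
      if ag: "?ag (n + 2 + Suc (segment (shift v) n)) c' w' v'" for c' w' v'
      using undef seg[OF ag, of n] ag by simp
    then show ?thesis unfolding refutes_def by metis
  next
    case (val n m)
    define a b where "a = segment (shift v) n" and "b = segment (shift (shift v)) m"
    \<comment> \<open>Large enough to fix both segments of \<open>v\<close>, the values of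
      \<open>w\<close> at their codes, and the one bit of \<open>c\<close> that is queried.\<close>
    define N where "N = n + m + 2 + Suc a + Suc b + Suc (prod_encode (w a - 1, w b - 1))"
    have "\<not> refutes c' w' v'" if ag: "?ag N c' w' v'" for c' w' v'
    proof -
      have *: "segment (shift v') n = a" "segment (shift (shift v')) m = b"
        using seg[OF ag, of n] seg[OF ag, of m] unfolding N_def a_def b_def by auto
      moreover have "w' a = w a" "w' b = w b" "v' 0 = v 0"
        "coded_rel c' (w a - 1) (w b - 1) = coded_rel c (w a - 1) (w b - 1)"
        using ag unfolding N_def coded_rel_def by auto
      ultimately show ?thesis
        using val unfolding refutes_def a_def[symmetric] b_def[symmetric] by metis
    qed
    then show ?thesis by metis
  qed
  then show "\<exists>N. \<forall>c' w' v'. ?ag N c' w' v' \<longrightarrow> ((c', w'), v') \<notin> {((c, w), v). refutes c w v}"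
    by simp
qed

text \<open>From a bad locally constant \<open>f\<close>, let \<open>w\<close> record the segments
  that force its value. Conversely, an unrefuted \<open>w\<close> for a quasi-order is defined along
  every \<open>X\<close>, and reading it at the first defined segment gives a bad array.\<close>

lemma not_BQO_iff: "c \<notin> BQO \<longleftrightarrow> (\<exists>w. \<forall>v. \<not> refutes c w v)"
proof
  assume "c \<notin> BQO"
  then have nb: "\<not> bqo (coded_rel c)" by (simp add: BQO_def)
  show "\<exists>w. \<forall>v. \<not> refutes c w v"
  proof (cases "quasi_order (coded_rel c)")
    case False
    then show ?thesis by (simp add: refutes_def)
  next
    case True
    then obtain f where f: "locally_constant f"
      and bad: "\<And>X. strict_mono X \<Longrightarrow> \<not> coded_rel c (f X) (f (shift X))"
      using nb unfolding bqo_iff_locally_constant by blast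
    define det where "det s a \<longleftrightarrow>
        (\<forall>X. strict_mono X \<longrightarrow> segment X (length (list_decode s)) = s \<longrightarrow> f X = a)" for s a
    \<comment> \<open>The value 0 means undefined. A segment that no increasing sequence extends
      forces every value vacuously, which is harmless because only increasing \<open>X\<close> are
      tested.\<close>
    define w where "w s = (if \<exists>a. det s a then Suc (SOME a. det s a) else 0)" for s
    have val: "w (segment X n) - 1 = f X" if "strict_mono X" "w (segment X n) \<noteq> 0" for X n
    proof -
      have "det (segment X n) (w (segment X n) - 1)"
        using that(2) unfolding w_def by (auto intro: someI split: if_splits)
      then show ?thesis using that(1) unfolding det_def length_segment by auto
    qed
    have def: "\<exists>n. w (segment X n) \<noteq> 0" if X: "strict_mono X" for X
    proof -
      obtain n where n: "\<And>Z. strict_mono Z \<Longrightarrow> (\<forall>i<n. Z i = X i) \<Longrightarrow> f Z = f X"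
        using f X unfolding locally_constant_def by blast
      then have "det (segment X n) (f X)"
        unfolding det_def length_segment segment_eq_iff by blast
      then show ?thesis unfolding w_def by (intro exI[of _ n]) auto
    qed
    have "\<not> refutes c w v" for v
    proof
      assume r: "refutes c w v"
      then have X: "strict_mono (shift v)" by (simp add: refutes_def)
      show False
      proof (cases "v 0")
        case 0
        then show False using r def[OF X] unfolding refutes_def by auto
      next
        case (Suc k)
        obtain n m where "k = prod_encode (n, m)" by (metis prod_decode_inverse surj_pair)
        then have "w (segment (shift v) n) \<noteq> 0" "w (segment (shift (shift v)) m) \<noteq> 0"
          "coded_rel c (w (segment (shift v) n) - 1) (w (segment (shift (shift v)) m) - 1)"
          using r Suc unfolding refutes_def by auto
        then show False using bad[OF X] val X strict_mono_shift by metis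
      qed
    qed
    then show ?thesis by blast
  qed
next
  assume "\<exists>w. \<forall>v. \<not> refutes c w v"
  then obtain w where w: "\<And>v. \<not> refutes c w v" by blast
  show "c \<notin> BQO"
  proof (cases "quasi_order (coded_rel c)")
    case False
    then show ?thesis by (simp add: BQO_def bqo_def)
  next
    case True
    have shift_case: "shift (case_nat t X) = X" for t and X :: baire
      by (simp add: shift_def)
    \<comment> \<open>Prefixing the tag 0 to \<open>X\<close> yields definedness; the tag of a pair
      \<open>(n, m)\<close>, used next, yields badness for all defined segments.\<close>
    have def: "\<exists>n. w (segment X n) \<noteq> 0" if X: "strict_mono X" for X
      using w[of "case_nat 0 X"] True X unfolding refutes_def shift_case by auto
    have bad: "\<not> coded_rel c (w (segment X n) - 1) (w (segment (shift X) m) - 1)"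
      if "strict_mono X" "w (segment X n) \<noteq> 0" "w (segment (shift X) m) \<noteq> 0" for X n m
      using w[of "case_nat (Suc (prod_encode (n, m))) X"] True that
      unfolding refutes_def shift_case by auto
    \<comment> \<open>With the least defined segment, the value depends only on the first
      \<open>l X\<close> entries.\<close>
    define l where "l X = (LEAST n. w (segment X n) \<noteq> 0)" for X
    have l: "w (segment X (l X)) \<noteq> 0" if "strict_mono X" for X
      using def[OF that] unfolding l_def by (rule LeastI_ex)
    define f where "f X = w (segment X (l X)) - 1" for X
    have "f Z = f X" if "strict_mono X" "strict_mono Z" "\<forall>i<l X. Z i = X i" for X Z
    proof -
      have seg: "segment Z n = segment X n" if "n \<le> l X" for n
        using that \<open>\<forall>i<l X. Z i = X i\<close> by (auto intro: segment_cong)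
      have "l Z = l X"
        unfolding l_def[of Z]
      proof (rule Least_equality)
        show "w (segment Z (l X)) \<noteq> 0" using l[OF that(1)] seg by simp
        fix n assume n: "w (segment Z n) \<noteq> 0"
        show "l X \<le> n"
        proof (rule ccontr)
          assume "\<not> l X \<le> n"
          then have "n < l X" by simp
          then have "w (segment X n) = 0" unfolding l_def using not_less_Least by blast
          then show False using n seg[of n] \<open>n < l X\<close> by simp
        qed
      qed
      then show ?thesis unfolding f_def using seg by simp
    qed
    then have "locally_constant f" unfolding locally_constant_def by blast
    moreover have "\<not> coded_rel c (f X) (f (shift X))" if "strict_mono X" for X
      unfolding f_def using bad l that strict_mono_shift by blast
    ultimately show ?thesis unfolding BQO_def bqo_iff_locally_constant by blast
  qed
qed

text \<open>The complement is the projection of the coanalytic set of pairs \<open>(c, w)\<close>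
  that no \<open>v\<close> refutes.\<close>

lemma Pi12_BQO: "Pi12 BQO"
proof -
  let ?F = "{((c, w), v). refutes c w v}"
  have "Pi11 (- fst ` ?F)"
    unfolding Pi11_def Sigma11_def using closed_refutes by auto
  moreover have "- BQO = fst ` (- fst ` ?F)"
  proof (intro set_eqI iffI)
    fix c assume "c \<in> - BQO"
    then obtain w where "\<And>v. \<not> refutes c w v" using not_BQO_iff by auto
    then have "(c, w) \<in> - fst ` ?F" by auto
    then show "c \<in> fst ` (- fst ` ?F)" by (metis fst_conv imageI)
  next
    fix c assume "c \<in> fst ` (- fst ` ?F)"
    then obtain w where "(c, w) \<notin> fst ` ?F" by auto
    then have "\<not> refutes c w v" for v by (auto simp: image_iff)
    then show "c \<in> - BQO" using not_BQO_iff by auto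
  qed
  ultimately show ?thesis unfolding Pi12_def Sigma12_def by blast
qed

section \<open>Ramsey properties of continuous arrays\<close>

lemma inf_subsets_mono: "A \<subseteq> B \<Longrightarrow> inf_subsets A \<subseteq> inf_subsets B"
  by (auto simp: inf_subsets_def)

lemma shift_in_inf_subsets: "X \<in> inf_subsets A \<Longrightarrow> shift X \<in> inf_subsets A"
  by (auto simp: inf_subsets_def shift_def strict_mono_def)

lemma funpow_shift: "(shift ^^ n) X = (\<lambda>k. X (n + k))"
  by (induction n) (auto simp: shift_def fun_eq_iff)

lemma funpow_shift_in_inf_subsets: "X \<in> inf_subsets A \<Longrightarrow> (shift ^^ n) X \<in> inf_subsets A"
  by (induction n) (auto intro: shift_in_inf_subsets)

text \<open>The values of \<open>f\<close> at \<open>Y\<close> and at its shift are fixed by an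
  initial segment of \<open>Y\<close>, so \<open>S\<close> is open and the open Ramsey theorem
  applies.\<close>

lemma ramsey_consecutive:
  assumes f: "locally_constant f" and A: "infinite A"
  shows "\<exists>B\<subseteq>A. infinite B \<and>
    ((\<forall>X\<in>inf_subsets B. P (f X) (f (shift X))) \<or> (\<forall>X\<in>inf_subsets B. \<not> P (f X) (f (shift X))))"
proof -
  define S where "S = {Y. P (f (enumerate Y)) (f (shift (enumerate Y)))}"
  have "initially_open S"
    unfolding initially_open_def
  proof (intro ballI impI)
    fix Y :: "nat set" assume "Y \<in> S" "infinite Y"
    then have X: "strict_mono (enumerate Y)" "strict_mono (shift (enumerate Y))"
      by (auto intro: strict_mono_enumerate strict_mono_shift)
    obtain n where n: "\<And>Z. strict_mono Z \<Longrightarrow> (\<forall>i<n. Z i = enumerate Y i) \<Longrightarrow> f Z = f (enumerate Y)"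
      using f X(1) unfolding locally_constant_def by meson
    obtain m where m: "\<And>Z. strict_mono Z \<Longrightarrow> (\<forall>i<m. Z i = shift (enumerate Y) i) \<Longrightarrow>
        f Z = f (shift (enumerate Y))"
      using f X(2) unfolding locally_constant_def by meson
    \<comment> \<open>The first \<open>n\<close> entries settle \<open>f\<close> at
      \<open>Y\<close>; \<open>m\<close> entries of the shift need \<open>Suc m\<close> entries of
      \<open>Y\<close>.\<close>
    define N where "N = enumerate Y (n + Suc m)"
    have "Z \<in> S" if Z: "infinite Z" "Z \<inter> {..<N} = Y \<inter> {..<N}" for Z
    proof -
      have eq: "enumerate Z i = enumerate Y i" if "i < n + Suc m" for i
        using enumerate_eq_of_initial_segment[OF \<open>infinite Y\<close> Z(1) _ that] Z(2) by (simp add: N_def)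
      have "f (enumerate Z) = f (enumerate Y)"
        using n Z(1) eq strict_mono_enumerate by simp
      moreover have "f (shift (enumerate Z)) = f (shift (enumerate Y))"
      proof (rule m)
        show "strict_mono (shift (enumerate Z))"
          using Z(1) by (intro strict_mono_shift strict_mono_enumerate)
        show "\<forall>i<m. shift (enumerate Z) i = shift (enumerate Y) i"
          using eq by (simp add: shift_def)
      qed
      ultimately show ?thesis using \<open>Y \<in> S\<close> unfolding S_def by simp
    qed
    then show "\<exists>n. \<forall>Z. infinite Z \<longrightarrow> Z \<inter> {..<n} = Y \<inter> {..<n} \<longrightarrow> Z \<in> S" by blast
  qed
  from ramsey_initially_open[OF this A] obtain B
    where B: "B \<subseteq> A" "infinite B" "homogeneous S {} B" by (elim exE conjE)
  have "range X \<subseteq> B" "infinite (range X)" "range X \<in> S \<longleftrightarrow> P (f X) (f (shift X))"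
    if "X \<in> inf_subsets B" for X
    using that infinite_range_strict_mono enumerate_range unfolding inf_subsets_def S_def by auto
  then have "(\<forall>X\<in>inf_subsets B. P (f X) (f (shift X))) \<or> (\<forall>X\<in>inf_subsets B. \<not> P (f X) (f (shift X)))"
    using B(3) unfolding homogeneous_def by simp metis
  then show ?thesis using B by (intro exI[of _ B]) simp
qed

lemma enumerate_in_inf_subsets: "infinite B \<Longrightarrow> enumerate B \<in> inf_subsets B"
  by (simp add: inf_subsets_def strict_mono_enumerate range_enumerate)

text \<open>The other alternative, strict decrease at every shift, would be an infinite descent in
  \<open>nat\<close>.\<close>

lemma ramsey_nondecreasing:
  fixes h :: "'q \<Rightarrow> nat"
  assumes "locally_constant f" "infinite A"
  shows "\<exists>B\<subseteq>A. infinite B \<and> (\<forall>X\<in>inf_subsets B. h (f X) \<le> h (f (shift X)))"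
proof -
  obtain B where B: "B \<subseteq> A" "infinite B" and hB: "(\<forall>X\<in>inf_subsets B. h (f X) \<le> h (f (shift X))) \<or>
      (\<forall>X\<in>inf_subsets B. \<not> h (f X) \<le> h (f (shift X)))"
    using ramsey_consecutive[OF assms, of "\<lambda>q q'. h q \<le> h q'"] by (elim exE conjE)
  have False if *: "\<forall>X\<in>inf_subsets B. \<not> h (f X) \<le> h (f (shift X))"
  proof -
    define X where "X = enumerate B"
    have X: "X \<in> inf_subsets B" unfolding X_def by (rule enumerate_in_inf_subsets[OF B(2)])
    have "h (f ((shift ^^ n) X)) + n \<le> h (f X)" for n
    proof (induction n)
      case (Suc n)
      have "(shift ^^ n) X \<in> inf_subsets B" using X by (rule funpow_shift_in_inf_subsets)
      then have "h (f (shift ((shift ^^ n) X))) < h (f ((shift ^^ n) X))" using * by (meson not_le)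
      then show ?case using Suc.IH by simp
    qed simp
    from this[of "Suc (h (f X))"] show False by simp
  qed
  then show ?thesis using B hB by meson
qed

text \<open>Pick increasing \<open>X n \<in> C n\<close>; the tail from position \<open>n\<close>
  stays in \<open>C n\<close> because the sets decrease.\<close>

lemma diagonal_sequence:
  fixes C :: "nat \<Rightarrow> nat set"
  assumes "\<And>n. infinite (C n)" and dec: "\<And>m n. m \<le> n \<Longrightarrow> C n \<subseteq> C m"
  shows "\<exists>X. strict_mono X \<and> (\<forall>n. (shift ^^ n) X \<in> inf_subsets (C n))"
proof -
  have "\<exists>X. \<forall>n. X n \<in> C n \<and> X n < X (Suc n)"
  proof (rule dependent_nat_choice)
    show "\<exists>a. a \<in> C 0" using assms(1) by (metis ex_in_conv finite.emptyI)
    show "\<exists>b. b \<in> C (Suc n) \<and> a < b" for a n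
      using assms(1)[of "Suc n"] by (meson infinite_nat_iff_unbounded)
  qed
  then obtain X where X: "\<And>n. X n \<in> C n" "\<And>n. X n < X (Suc n)" by blast
  then have mono: "strict_mono X" by (simp add: strict_mono_Suc_iff)
  moreover have "X (n + k) \<in> C n" for n k
    using X(1)[of "n + k"] dec[of n "n + k"] by auto
  ultimately have "(shift ^^ n) X \<in> inf_subsets (C n)" for n
    by (auto simp: inf_subsets_def funpow_shift strict_mono_def)
  then show ?thesis using mono by (intro exI[of _ X]) simp
qed

text \<open>Iterated shrinking in which stage \<open>Suc m\<close> may use that \<open>K m\<close>
  holds of the set being shrunk.\<close>

lemma decreasing_sequence:
  assumes step: "\<And>n A. infinite A \<Longrightarrow> A \<subseteq> A0 \<Longrightarrow> (\<And>m. n = Suc m \<Longrightarrow> K m A) \<Longrightarrow>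
      \<exists>B\<subseteq>A. infinite B \<and> K n B"
    and A0: "infinite (A0 :: nat set)"
  shows "\<exists>C. (\<forall>n. infinite (C n) \<and> C n \<subseteq> A0 \<and> K n (C n)) \<and> (\<forall>m n. m \<le> n \<longrightarrow> C n \<subseteq> C m)"
proof -
  have "\<exists>C. \<forall>n. (infinite (C n) \<and> C n \<subseteq> A0 \<and> K n (C n)) \<and> C (Suc n) \<subseteq> C n"
  proof (rule dependent_nat_choice)
    show "\<exists>C. infinite C \<and> C \<subseteq> A0 \<and> K 0 C" using step[of A0 0] A0 by auto
    show "\<exists>C'. (infinite C' \<and> C' \<subseteq> A0 \<and> K (Suc n) C') \<and> C' \<subseteq> C"
      if "infinite C \<and> C \<subseteq> A0 \<and> K n C" for C n
      using step[of C "Suc n"] that by (metis nat.inject order_trans)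
  qed
  then obtain C where C: "\<forall>n. (infinite (C n) \<and> C n \<subseteq> A0 \<and> K n (C n)) \<and> C (Suc n) \<subseteq> C n"
    by (elim exE)
  then have "C n \<subseteq> C m" if "m \<le> n" for m n
    using lift_Suc_antimono_le[of C, OF _ that] by blast
  then show ?thesis using C by (intro exI[of _ C]) simp
qed

text \<open>Otherwise each number \<open>n\<close> could be avoided on some \<open>C n\<close>. A
  diagonal \<open>X\<close> then has a value other than \<open>n\<close> at its \<open>n\<close>-th
  shift, while invariance keeps the value fixed: take that value for \<open>n\<close>.\<close>

lemma ramsey_shift_invariant:
  fixes h :: "'q \<Rightarrow> nat"
  assumes f: "locally_constant f" and A: "infinite A"
    and inv: "\<And>X. X \<in> inf_subsets A \<Longrightarrow> h (f (shift X)) = h (f X)"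
  shows "\<exists>B\<subseteq>A. infinite B \<and> (\<exists>v. \<forall>X\<in>inf_subsets B. h (f X) = v)"
proof (rule ccontr)
  assume neg: "\<not> ?thesis"
  have step: "\<exists>B\<subseteq>A'. infinite B \<and> (\<forall>X\<in>inf_subsets B. h (f X) \<noteq> v)"
    if A': "infinite A'" "A' \<subseteq> A" for v A'
  proof -
    obtain B where "B \<subseteq> A'" "infinite B"
      "(\<forall>X\<in>inf_subsets B. h (f X) = v) \<or> (\<forall>X\<in>inf_subsets B. h (f X) \<noteq> v)"
      using ramsey_consecutive[OF f A'(1), of "\<lambda>q _. h q = v"] by (elim exE conjE)
    then show ?thesis using neg A'(2) by (meson order_trans)
  qed
  have "\<exists>C. (\<forall>n. infinite (C n) \<and> C n \<subseteq> A \<and> (\<forall>X\<in>inf_subsets (C n). h (f X) \<noteq> n)) \<and>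
      (\<forall>m n. m \<le> n \<longrightarrow> C n \<subseteq> C m)"
    by (rule decreasing_sequence[OF _ A]) (rule step)
  then obtain C where "\<forall>n. infinite (C n) \<and> C n \<subseteq> A \<and> (\<forall>X\<in>inf_subsets (C n). h (f X) \<noteq> n)"
    and "\<forall>m n. m \<le> n \<longrightarrow> C n \<subseteq> C m"
    by (elim exE conjE)
  then have C: "infinite (C n)" "C n \<subseteq> A" "\<forall>X\<in>inf_subsets (C n). h (f X) \<noteq> n"
    "m \<le> n \<Longrightarrow> C n \<subseteq> C m" for m n
    by simp_all
  have "\<exists>X. strict_mono X \<and> (\<forall>n. (shift ^^ n) X \<in> inf_subsets (C n))"
    by (rule diagonal_sequence) (use C in simp_all)
  then obtain X where "\<forall>n. (shift ^^ n) X \<in> inf_subsets (C n)"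
    by (elim exE conjE)
  then have X: "(shift ^^ n) X \<in> inf_subsets (C n)" for n by simp
  have XA: "(shift ^^ n) X \<in> inf_subsets A" for n using X C(2) inf_subsets_mono by blast
  have "h (f ((shift ^^ n) X)) = h (f X)" for n
    by (induction n) (use inv[OF XA] in auto)
  then show False using X C(3) by metis
qed

section \<open>The order on codes of finite data\<close>

text \<open>A nonempty list is coded as the successor of the pair of its head and the code of its
  tail; for \<open>i > 0\<close> this is the code of the tail.\<close>

definition parent :: "nat \<Rightarrow> nat" where
  "parent i = snd (prod_decode (i - 1))"

text \<open>The components of a pair do not exceed its code. The bound on \<open>a\<close> will give
  \<open>a \<le> X 0\<close>; the bound on \<open>parent i\<close> keeps the parent among the
  columns up to \<open>i\<close>.\<close>

lemma list_decode_parent: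
  assumes "0 < i"
  obtains a where "a < i" "parent i < i" "list_decode i = a # list_decode (parent i)"
proof -
  obtain k where k: "i = Suc k" using assms by (cases i) auto
  obtain a p where ap: "prod_decode k = (a, p)" by (metis surj_pair)
  then have "k = prod_encode (a, p)" by (metis prod_decode_inverse)
  then have "a \<le> k" "p \<le> k" by (simp_all add: le_prod_encode_1 le_prod_encode_2)
  then show ?thesis using that[of a] k ap by (simp add: parent_def)
qed

text \<open>Hence the columns up to \<open>label q\<close> of a guess suffice to test every node
  with code at most \<open>label q\<close>.\<close>

lemma length_list_decode_le: "length (list_decode i) \<le> i"
proof (induction i rule: less_induct)
  case (less i)
  show ?case
  proof (cases "i = 0")
    case False
    then obtain a where "parent i < i" "list_decode i = a # list_decode (parent i)"
      using list_decode_parent by blast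
    then show ?thesis using less.IH[of "parent i"] by simp
  qed simp
qed

text \<open>The default 0 lets every number code some triple.\<close>

definition entry_of :: "nat \<Rightarrow> nat \<Rightarrow> nat" where
  "entry_of k i = (if i < length (list_decode k) then list_decode k ! i else 0)"

text \<open>
  Natural numbers \<open>i\<close> stand for nodes \<open>list_decode i\<close>, written with the last entry first, so
  that the tail of a list is the parent of a node and has a smaller code. The number \<open>q\<close> codes the
  triple of \<open>n = label q\<close>, \<open>c = rank_at q\<close> and \<open>u = guess q\<close>, where only the arguments
  \<open>i \<le> n\<close> of \<open>c\<close> and \<open>u\<close> matter.
\<close>

definition label :: "nat \<Rightarrow> nat" where
  "label q = fst (prod_decode q)"

definition rank_at :: "nat \<Rightarrow> nat \<Rightarrow> nat" where
  "rank_at q = entry_of (fst (prod_decode (snd (prod_decode q))))"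

definition guess :: "nat \<Rightarrow> nat \<Rightarrow> nat" where
  "guess q = entry_of (snd (prod_decode (snd (prod_decode q))))"

definition element :: "nat \<Rightarrow> (nat \<Rightarrow> nat) \<Rightarrow> (nat \<Rightarrow> nat) \<Rightarrow> nat" where
  "element n c u = prod_encode (n, prod_encode
     (list_encode (map c [0..<Suc n]), list_encode (map u [0..<Suc n])))"

lemma element_simps [simp]:
  "label (element n c u) = n"
  "i \<le> n \<Longrightarrow> rank_at (element n c u) i = c i"
  "i \<le> n \<Longrightarrow> guess (element n c u) i = u i"
  by (simp_all add: label_def rank_at_def guess_def element_def entry_of_def nth_append del: upt_Suc)

lemma element_cong:
  assumes "\<And>i. i \<le> n \<Longrightarrow> c i = c' i"
  shows "element n c u = element n c' u"
proof -
  have "map c [0..<Suc n] = map c' [0..<Suc n]"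
    using assms by (auto simp: less_Suc_eq_le)
  then show ?thesis unfolding element_def by metis
qed

text \<open>
  \<open>q'\<close> dominates \<open>q\<close> if some column \<open>i \<le> label q\<close> violates what a bad array must satisfy
  and no earlier column decreases. Decreases can be removed from finitely many columns by
  Ramsey's theorem, and they are what makes the relation transitive.
\<close>

definition columns_le :: "nat \<Rightarrow> nat \<Rightarrow> nat \<Rightarrow> bool" where
  "columns_le q q' i \<longleftrightarrow> (\<forall>j\<le>i. rank_at q j \<le> rank_at q' j \<and> guess q j \<le> guess q' j)"

text \<open>The two possible violations: a guess increases, or a child one shift later outranks its
  parent. Code 0 is the root, which has no parent.\<close>

definition rises :: "nat \<Rightarrow> nat \<Rightarrow> nat \<Rightarrow> bool" where
  "rises q q' i \<longleftrightarrow> guess q i < guess q' i \<or> 0 < i \<and> rank_at q (parent i) < rank_at q' i"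

definition dominated :: "nat \<Rightarrow> nat \<Rightarrow> bool" where
  "dominated q q' \<longleftrightarrow> label q \<le> label q' \<and>
     (label q = label q' \<and> columns_le q q' (label q) \<or>
      (\<exists>i\<le>label q. rises q q' i \<and> columns_le q q' i))"

section \<open>Transitivity of domination\<close>

lemma columns_le_antimono: "columns_le q q' i \<Longrightarrow> j \<le> i \<Longrightarrow> columns_le q q' j"
  unfolding columns_le_def by auto

lemma columns_le_trans: "columns_le q q' i \<Longrightarrow> columns_le q' q'' i \<Longrightarrow> columns_le q q'' i"
  unfolding columns_le_def by (meson order_trans)

lemma rises_columns_le: "rises q q' i \<Longrightarrow> columns_le q' q'' i \<Longrightarrow> rises q q'' i"
  unfolding rises_def columns_le_def by (meson less_le_trans order_refl)

text \<open>A parent has a smaller code than its child, so \<open>columns_le\<close> up to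
  \<open>i\<close> also controls the rank at \<open>parent i\<close>.\<close>

lemma columns_le_rises:
  assumes "columns_le q q' i" "rises q' q'' i"
  shows "rises q q'' i"
proof (cases "guess q' i < guess q'' i")
  case True
  then show ?thesis using assms(1) unfolding rises_def columns_le_def by (meson le_less_trans order_refl)
next
  case False
  then have i: "0 < i" "rank_at q' (parent i) < rank_at q'' i" using assms(2) by (auto simp: rises_def)
  then have "parent i \<le> i" using list_decode_parent less_imp_le by metis
  then show ?thesis using i assms(1) unfolding rises_def columns_le_def by (meson le_less_trans)
qed

text \<open>Rises at columns \<open>i\<close> and \<open>j\<close> compose to a rise at the smaller
  one, up to which neither step decreases. If one step is instead monotone in all columns of its
  source, the column of the other serves.\<close>

lemma dominated_trans:
  assumes 1: "dominated q q'" and 2: "dominated q' q''"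
  shows "dominated q q''"
proof -
  have lab: "label q \<le> label q'" "label q' \<le> label q''"
    using assms by (auto simp: dominated_def)
  have riseI: "dominated q q''" if "i \<le> label q" "rises q q'' i" "columns_le q q'' i" for i
    using that lab unfolding dominated_def by auto
  consider (same) "label q = label q'" "columns_le q q' (label q)"
    | (rise) i where "i \<le> label q" "rises q q' i" "columns_le q q' i"
    using 1 unfolding dominated_def by blast
  then show ?thesis
  proof cases
    case same
    consider "label q' = label q''" "columns_le q' q'' (label q')"
      | i where "i \<le> label q'" "rises q' q'' i" "columns_le q' q'' i"
      using 2 unfolding dominated_def by blast
    then show ?thesis
    proof cases
      case 1
      then show ?thesis using same columns_le_trans unfolding dominated_def by auto
    next
      case (2 i)
      have "columns_le q q' i" using same 2(1) columns_le_antimono by metis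
      then show ?thesis
        using riseI 2 same(1) columns_le_rises columns_le_trans by metis
    qed
  next
    case (rise i)
    consider "columns_le q' q'' (label q')"
      | j where "j \<le> label q'" "rises q' q'' j" "columns_le q' q'' j"
      using 2 unfolding dominated_def by blast
    then show ?thesis
    proof cases
      case 1
      then have "columns_le q' q'' i" using rise(1) lab(1) columns_le_antimono order_trans by metis
      then show ?thesis using riseI rise rises_columns_le columns_le_trans by metis
    next
      case (2 j)
      show ?thesis
      proof (cases "i \<le> j")
        case True
        then have "columns_le q' q'' i" using 2(3) columns_le_antimono by metis
        then show ?thesis using riseI rise rises_columns_le columns_le_trans by metis
      next
        case False
        then have "j \<le> i" by simp
        then have "columns_le q q' j" using rise(3) columns_le_antimono by metis
        then show ?thesis
          using riseI[of j] 2 columns_le_rises columns_le_trans \<open>j \<le> i\<close> rise(1) order_trans by metis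
      qed
    qed
  qed
qed

lemma dominated_refl: "dominated q q"
  by (simp add: dominated_def columns_le_def)

section \<open>Hardness\<close>

text \<open>The tree of the closed set \<open>F\<close> over \<open>(x, u)\<close>, with nodes
  reversed. Only the first \<open>length r\<close> values of \<open>x\<close> and \<open>u\<close>
  enter, hence the continuity of the reduction.\<close>

definition node :: "((baire \<times> baire) \<times> baire) set \<Rightarrow> baire \<Rightarrow> baire \<Rightarrow> nat list \<Rightarrow> bool" where
  "node F x u r \<longleftrightarrow> (\<exists>x' u' z. ((x', u'), z) \<in> F \<and>
     (\<forall>j<length r. x' j = x j \<and> u' j = u j \<and> z j = rev r ! j))"

lemma node_tail: "node F x u (a # r) \<Longrightarrow> node F x u r"
  unfolding node_def by (force simp: nth_append)

lemma node_cong: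
  assumes "\<And>j. j < length r \<Longrightarrow> x j = x' j" "\<And>j. j < length r \<Longrightarrow> u j = u' j"
  shows "node F x u r \<longleftrightarrow> node F x' u' r"
  unfolding node_def using assms by simp

lemma node_prefix: "((x, u), z) \<in> F \<Longrightarrow> node F x u (rev (map z [0..<n]))"
  unfolding node_def by auto

text \<open>Every basic neighbourhood of the point meets \<open>F\<close>.\<close>

lemma branch_in_closed:
  assumes "closed F" "\<And>n. node F x u (rev (map z [0..<n]))"
  shows "((x, u), z) \<in> F"
proof (rule ccontr)
  assume "((x, u), z) \<notin> F"
  from closed_imp_finitely_refuted[OF assms(1) this] obtain N where
    N: "\<forall>x' u' z'. (\<forall>i<N. x' i = x i \<and> u' i = u i \<and> z' i = z i) \<longrightarrow> ((x', u'), z') \<notin> F"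
    by (elim exE)
  then show False using assms(2)[of N] unfolding node_def by auto
qed

definition legal :: "((baire \<times> baire) \<times> baire) set \<Rightarrow> baire \<Rightarrow> nat \<Rightarrow> bool" where
  "legal F x q \<longleftrightarrow> (\<forall>i\<le>label q. node F x (guess q) (list_decode i) \<longrightarrow>
     length (list_decode i) \<le> rank_at q i)"

text \<open>Illegal codes form a top class.\<close>

definition node_order :: "((baire \<times> baire) \<times> baire) set \<Rightarrow> baire \<Rightarrow> nat \<Rightarrow> nat \<Rightarrow> bool" where
  "node_order F x q q' \<longleftrightarrow> \<not> legal F x q' \<or> legal F x q \<and> dominated q q'"

lemma quasi_order_node_order: "quasi_order (node_order F x)"
  unfolding quasi_order_def reflp_def transp_def node_order_def
  using dominated_refl dominated_trans by blast

definition node_code :: "((baire \<times> baire) \<times> baire) set \<Rightarrow> baire \<Rightarrow> cantor" where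
  "node_code F x k = node_order F x (fst (prod_decode k)) (snd (prod_decode k))"

lemma coded_rel_node_code: "coded_rel (node_code F x) = node_order F x"
  by (simp add: fun_eq_iff coded_rel_def node_code_def)

section \<open>Continuity of the reduction\<close>

lemma legal_cong:
  assumes "\<And>j. j < label q \<Longrightarrow> x j = x' j"
  shows "legal F x q \<longleftrightarrow> legal F x' q"
proof -
  have "node F x (guess q) (list_decode i) \<longleftrightarrow> node F x' (guess q) (list_decode i)"
    if "i \<le> label q" for i
    by (rule node_cong) (use assms that length_list_decode_le[of i] in auto)
  then show ?thesis unfolding legal_def by auto
qed

text \<open>Each bit compares two codes, whose legality reads \<open>x\<close> only below their
  labels.\<close>

lemma continuous_node_code: "continuous_on UNIV (node_code F)"
proof (rule continuous_on_coordinatewise_then_product)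
  fix k
  define q q' where "q = fst (prod_decode k)" and "q' = snd (prod_decode k)"
  have eq: "node_code F x k = node_code F x' k" if "\<forall>j<label q + label q'. x' j = x j" for x x'
  proof -
    have "legal F x q = legal F x' q" "legal F x q' = legal F x' q'"
      by (rule legal_cong, use that in simp)+
    then show ?thesis
      unfolding node_code_def q_def[symmetric] q'_def[symmetric] node_order_def by simp
  qed
  have "open ((\<lambda>x. node_code F x k) -` S)" for S
  proof (subst open_subopen, intro ballI)
    fix x assume x: "x \<in> (\<lambda>x. node_code F x k) -` S"
    have "{x'. \<forall>j<label q + label q'. x' j = x j} \<subseteq> (\<lambda>x. node_code F x k) -` S"
    proof
      fix x' assume "x' \<in> {x'. \<forall>j<label q + label q'. x' j = x j}"
      then have "node_code F x k = node_code F x' k" by (intro eq) simp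
      then show "x' \<in> (\<lambda>x. node_code F x k) -` S" using x by simp
    qed
    then show "\<exists>T. open T \<and> x \<in> T \<and> T \<subseteq> (\<lambda>x. node_code F x k) -` S"
      using open_cylinder[of "label q + label q'" x] by (intro exI conjI) (assumption, auto)
  qed
  then show "continuous_on UNIV (\<lambda>x. node_code F x k)"
    by (simp add: continuous_on_open_vimage)
qed

section \<open>Bounded heights in a well-founded tree\<close>

text \<open>Some \<open>k\<close> further entries, bounded in turn by \<open>X 0\<close>,
  \<open>X 1\<close> and so on, lead from \<open>r\<close> to a node of \<open>T\<close>. Only the
  last node is tested; for a tree the intermediate ones follow.\<close>

fun bounded_extension :: "(nat list \<Rightarrow> bool) \<Rightarrow> nat \<Rightarrow> nat list \<Rightarrow> baire \<Rightarrow> bool" where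
  "bounded_extension T 0 r X \<longleftrightarrow> T r"
| "bounded_extension T (Suc k) r X \<longleftrightarrow> (\<exists>a\<le>X 0. bounded_extension T k (a # r) (shift X))"

text \<open>For a node of a tree this is one more than the highest level reachable above
  \<open>r\<close> within the bounds \<open>X\<close>. Counting levels from the root is what makes
  the passage to a child monotone.\<close>

definition bounded_height :: "(nat list \<Rightarrow> bool) \<Rightarrow> nat list \<Rightarrow> baire \<Rightarrow> nat" where
  "bounded_height T r X =
     (if T r then length r + (LEAST k. \<not> bounded_extension T k r X) else 0)"

text \<open>Abstracts the tree \<open>node F x y\<close> of a section without points.\<close>

locale wf_tree =
  fixes T :: "nat list \<Rightarrow> bool"
  assumes tail: "\<And>a r. T (a # r) \<Longrightarrow> T r"
    and no_branch: "\<And>z. \<exists>n. \<not> T (rev (map z [0..<n]))"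
begin

lemma append_closed: "T (s @ r) \<Longrightarrow> T r"
  by (induction s) (auto dest: tail)

lemma bounded_extension_Suc: "bounded_extension T (Suc k) r X \<Longrightarrow> bounded_extension T k r X"
proof (induction k arbitrary: r X)
  case 0
  then show ?case using tail by auto
next
  case (Suc k)
  then obtain a where "a \<le> X 0" "bounded_extension T (Suc k) (a # r) (shift X)" by auto
  then have "bounded_extension T k (a # r) (shift X)" using Suc.IH by blast
  then show ?case using \<open>a \<le> X 0\<close> by auto
qed

lemma bounded_extension_antimono:
  "bounded_extension T k r X \<Longrightarrow> j \<le> k \<Longrightarrow> bounded_extension T j r X"
  by (induction k) (auto simp: le_Suc_eq dest: bounded_extension_Suc simp del: bounded_extension.simps(2))

text \<open>Koenig's argument: only the finitely many \<open>a \<le> X 0\<close> compete, so bounds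
  \<open>K a\<close> for all of them would give a common bound \<open>M\<close>.\<close>

lemma extend_infinite_extension:
  assumes "\<And>k. bounded_extension T k r X"
  shows "\<exists>a. \<forall>k. bounded_extension T k (a # r) (shift X)"
proof (rule ccontr)
  assume "\<not> ?thesis"
  then obtain K where K: "\<And>a. \<not> bounded_extension T (K a) (a # r) (shift X)" by metis
  define M where "M = Max (K ` {..X 0})"
  obtain a where "a \<le> X 0" "bounded_extension T M (a # r) (shift X)"
    using assms[of "Suc M"] by auto
  moreover have "K a \<le> M" unfolding M_def using \<open>a \<le> X 0\<close> by (intro Max_ge) auto
  ultimately show False using K bounded_extension_antimono by blast
qed

text \<open>Iterating the previous lemma would extend \<open>r\<close> to an infinite branch
  \<open>z\<close>, consisting of \<open>rev r\<close> followed by the chosen entries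
  \<open>a\<close>.\<close>

lemma bounded_extension_stops: "\<exists>k. \<not> bounded_extension T k r X"
proof (rule ccontr)
  assume "\<not> ?thesis"
  then have start: "\<forall>k. bounded_extension T k r X" by simp
  have "\<exists>R. \<forall>n. ((\<forall>k. bounded_extension T k (R n) ((shift ^^ n) X)) \<and> (n = 0 \<longrightarrow> R n = r)) \<and>
      (\<exists>a. R (Suc n) = a # R n)"
  proof (rule dependent_nat_choice)
    show "\<exists>s. (\<forall>k. bounded_extension T k s ((shift ^^ 0) X)) \<and> (0 = 0 \<longrightarrow> s = r)"
      using start by auto
    fix s n
    assume "(\<forall>k. bounded_extension T k s ((shift ^^ n) X)) \<and> (n = 0 \<longrightarrow> s = r)"
    then obtain a where "\<forall>k. bounded_extension T k (a # s) (shift ((shift ^^ n) X))"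
      using extend_infinite_extension by blast
    then show "\<exists>s'. ((\<forall>k. bounded_extension T k s' ((shift ^^ Suc n) X)) \<and> (Suc n = 0 \<longrightarrow> s' = r)) \<and>
        (\<exists>a. s' = a # s)"
      by auto
  qed
  then obtain R where R: "\<forall>n. ((\<forall>k. bounded_extension T k (R n) ((shift ^^ n) X)) \<and>
      (n = 0 \<longrightarrow> R n = r)) \<and> (\<exists>a. R (Suc n) = a # R n)"
    by (elim exE)
  then have "bounded_extension T 0 (R n) ((shift ^^ n) X)" for n by blast
  then have T: "T (R n)" for n by simp
  define a where "a n = hd (R (Suc n))" for n
  have Rn: "R n = rev (map a [0..<n]) @ r" for n
  proof (induction n)
    case (Suc n)
    have "R (Suc n) = a n # R n" using R unfolding a_def by (metis list.sel(1))
    then show ?case using Suc.IH by simp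
  qed (use R in simp)
  define z where "z i = (if i < length r then rev r ! i else a (i - length r))" for i
  have "map z [0..<length r + n] = rev r @ map a [0..<n]" for n
    by (rule nth_equalityI) (auto simp: z_def nth_append)
  then have Tz: "T (rev (map z [0..<length r + n]))" for n
    using T[of n] unfolding Rn by simp
  have "T (rev (map z [0..<n]))" for n
  proof -
    have "[0..<length r + n] = [0..<n] @ [n..<length r + n]"
      using upt_add_eq_append[of 0 n "length r"] by (simp add: add.commute)
    then show ?thesis using Tz[of n] append_closed by simp
  qed
  then show False using no_branch by blast
qed

lemma bounded_height_ge: "T r \<Longrightarrow> length r \<le> bounded_height T r X"
  by (simp add: bounded_height_def)

text \<open>If \<open>k\<close> steps from \<open>r\<close> are impossible, so are
  \<open>k - 1\<close> steps from the child with the shifted bounds; the extra length of the child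
  makes up for the lost step.\<close>

lemma bounded_height_child:
  assumes "a \<le> X 0"
  shows "bounded_height T (a # r) (shift X) \<le> bounded_height T r X"
proof (cases "T (a # r)")
  case True
  define k where "k = (LEAST k. \<not> bounded_extension T k r X)"
  have k: "\<not> bounded_extension T k r X"
    unfolding k_def using bounded_extension_stops by (rule LeastI_ex)
  have "T r" using True tail by blast
  then obtain k' where k': "k = Suc k'" using k by (cases k) auto
  then have "\<not> bounded_extension T k' (a # r) (shift X)" using k assms by auto
  then have "(LEAST k. \<not> bounded_extension T k (a # r) (shift X)) \<le> k'" by (rule Least_le)
  then show ?thesis
    using True \<open>T r\<close> k' unfolding bounded_height_def k_def[symmetric] by simp
qed (simp add: bounded_height_def)

lemma bounded_extension_cong:
  "(\<And>i. i < k \<Longrightarrow> X i = Y i) \<Longrightarrow> bounded_extension T k r X \<longleftrightarrow> bounded_extension T k r Y"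
proof (induction k arbitrary: r X Y)
  case (Suc k)
  have "bounded_extension T k (a # r) (shift X) \<longleftrightarrow> bounded_extension T k (a # r) (shift Y)" for a
    using Suc.prems by (intro Suc.IH) (simp add: shift_def)
  moreover have "X 0 = Y 0" using Suc.prems by simp
  ultimately show ?case by simp
qed simp

text \<open>Extensions by \<open>j\<close> entries read only the first \<open>j\<close> bounds, so
  the least failing \<open>k\<close> depends on the first \<open>k\<close> entries of
  \<open>X\<close>.\<close>

lemma bounded_height_local: "\<exists>n. \<forall>Y. (\<forall>i<n. Y i = X i) \<longrightarrow> bounded_height T r Y = bounded_height T r X"
proof -
  define k where "k = (LEAST k. \<not> bounded_extension T k r X)"
  have k: "\<not> bounded_extension T k r X"
    unfolding k_def using bounded_extension_stops by (rule LeastI_ex)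
  have below: "bounded_extension T j r X" if "j < k" for j
    using that not_less_Least unfolding k_def by blast
  have "(LEAST k. \<not> bounded_extension T k r Y) = k" if "\<forall>i<k. Y i = X i" for Y
  proof (rule Least_equality)
    have eq: "bounded_extension T j r Y \<longleftrightarrow> bounded_extension T j r X" if "j \<le> k" for j
      using \<open>\<forall>i<k. Y i = X i\<close> that by (intro bounded_extension_cong) simp
    show "\<not> bounded_extension T k r Y" using k eq by simp
    show "k \<le> j" if "\<not> bounded_extension T j r Y" for j
      using that eq[of j] below[of j] by (meson less_imp_le not_le)
  qed
  then show ?thesis unfolding bounded_height_def k_def[symmetric] by metis
qed

text \<open>The label \<open>X 0\<close> limits the columns to nodes whose last entry is below
  \<open>X 0\<close>, as \<open>bounded_height_child\<close> needs.\<close>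

definition height_array :: "baire \<Rightarrow> baire \<Rightarrow> nat" where
  "height_array y X = element (X 0) (\<lambda>i. bounded_height T (list_decode i) X) y"

lemma locally_constant_height_array: "locally_constant (height_array y)"
  unfolding locally_constant_def
proof (intro allI impI)
  fix X :: baire
  have "\<forall>i. \<exists>n. \<forall>Y. (\<forall>j<n. Y j = X j) \<longrightarrow>
      bounded_height T (list_decode i) Y = bounded_height T (list_decode i) X"
    using bounded_height_local by blast
  from choice[OF this] obtain n where "\<forall>i Y. (\<forall>j<n i. Y j = X j) \<longrightarrow>
      bounded_height T (list_decode i) Y = bounded_height T (list_decode i) X"
    by (elim exE)
  then have n: "bounded_height T (list_decode i) Y = bounded_height T (list_decode i) X"
    if "\<forall>j<n i. Y j = X j" for i Y
    using that by blast
  \<comment> \<open>The \<open>Suc\<close> makes \<open>N\<close> positive, so that agreement below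
    \<open>N\<close> also preserves the label \<open>X 0\<close>.\<close>
  define N where "N = Suc (Max (n ` {..X 0}))"
  have "height_array y Y = height_array y X" if Y: "\<forall>j<N. Y j = X j" for Y
  proof -
    have *: "bounded_height T (list_decode i) Y = bounded_height T (list_decode i) X" if "i \<le> X 0" for i
    proof (rule n)
      have "n i < N" unfolding N_def less_Suc_eq_le using that by (intro Max_ge) auto
      then show "\<forall>j<n i. Y j = X j" using Y by simp
    qed
    have "Y 0 = X 0" using Y by (simp add: N_def)
    show ?thesis unfolding height_array_def \<open>Y 0 = X 0\<close> by (rule element_cong) (rule *)
  qed
  then show "\<exists>n. \<forall>Z. strict_mono Z \<longrightarrow> (\<forall>i<n. Z i = X i) \<longrightarrow> height_array y Z = height_array y X"
    by blast
qed

text \<open>Labels increase strictly, which leaves only a rise. Guesses are constantly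
  \<open>y\<close>, and \<open>bounded_height_child\<close> excludes a rise in rank.\<close>

lemma not_dominated_height_array:
  assumes "strict_mono X"
  shows "\<not> dominated (height_array y X) (height_array y (shift X))"
proof -
  have less: "X 0 < shift X 0" using assms by (simp add: shift_def strict_mono_def)
  have "\<not> rises (height_array y X) (height_array y (shift X)) i" if i: "i \<le> X 0" for i
  proof -
    have "bounded_height T (list_decode i) (shift X) \<le> bounded_height T (list_decode (parent i)) X"
      "parent i \<le> X 0" if pos: "0 < i"
    proof -
      obtain a where a: "a < i" "parent i < i" "list_decode i = a # list_decode (parent i)"
        using list_decode_parent[OF pos] .
      then show "parent i \<le> X 0" using i by simp
      show "bounded_height T (list_decode i) (shift X) \<le> bounded_height T (list_decode (parent i)) X"
        unfolding a(3) by (rule bounded_height_child) (use a(1) i in simp)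
    qed
    then show ?thesis
      using i less by (cases "i = 0") (simp_all add: rises_def height_array_def not_less)
  qed
  moreover have "label (height_array y X) = X 0" "label (height_array y (shift X)) = shift X 0"
    by (simp_all add: height_array_def)
  ultimately show ?thesis using less unfolding dominated_def by auto
qed

end

text \<open>The array \<open>height_array y\<close> is bad: its values are legal because heights are
  at least lengths, and legal codes compare by \<open>dominated\<close>.\<close>

lemma not_bqo_node_order:
  assumes F: "closed F" and y: "\<And>z. ((x, y), z) \<notin> F"
  shows "\<not> bqo (node_order F x)"
proof -
  interpret wf_tree "node F x y"
    by standard (use node_tail branch_in_closed[OF F] y in blast)+
  have "legal F x (height_array y X)" for X
    unfolding legal_def
  proof (intro allI impI)
    fix i assume i: "i \<le> label (height_array y X)"
      and nd: "node F x (guess (height_array y X)) (list_decode i)"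
    then have "i \<le> X 0" by (simp add: height_array_def)
    have "node F x y (list_decode i)"
      using nd node_cong[of "list_decode i" x x "guess (height_array y X)" y F]
        \<open>i \<le> X 0\<close> length_list_decode_le[of i] by (simp add: height_array_def)
    then show "length (list_decode i) \<le> rank_at (height_array y X) i"
      using bounded_height_ge \<open>i \<le> X 0\<close> by (simp add: height_array_def)
  qed
  then have "\<not> node_order F x (height_array y X) (height_array y (shift X))" if "strict_mono X" for X
    using not_dominated_height_array[OF that] by (simp add: node_order_def)
  then show ?thesis
    using locally_constant_height_array unfolding bqo_iff_locally_constant by blast
qed


section \<open>From a bad array to a section without points\<close>

locale legal_array =
  fixes F :: "((baire \<times> baire) \<times> baire) set" and x :: baire
    and f :: "baire \<Rightarrow> nat" and A0 :: "nat set"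
  assumes f: "locally_constant f" and A0: "infinite A0"
    and legal: "\<And>X. X \<in> inf_subsets A0 \<Longrightarrow> legal F x (f X)"
    and bad: "\<And>X. X \<in> inf_subsets A0 \<Longrightarrow> \<not> dominated (f X) (f (shift X))"
begin

text \<open>Otherwise the labels could be made equal to a fixed \<open>N\<close>. Making the
  finitely many columns up to \<open>N\<close> nondecreasing then produces domination between codes
  of the same label.\<close>

lemma labels_increasing:
  "\<exists>B\<subseteq>A0. infinite B \<and> (\<forall>X\<in>inf_subsets B. label (f X) < label (f (shift X)))"
proof -
  obtain B where B: "B \<subseteq> A0" "infinite B" "\<forall>X\<in>inf_subsets B. label (f X) \<le> label (f (shift X))"
    using ramsey_nondecreasing[OF f A0, of label] by (elim exE conjE)
  obtain C where C: "C \<subseteq> B" "infinite C"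
    "(\<forall>X\<in>inf_subsets C. label (f X) < label (f (shift X))) \<or>
     (\<forall>X\<in>inf_subsets C. \<not> label (f X) < label (f (shift X)))"
    using ramsey_consecutive[OF f B(2), of "\<lambda>q q'. label q < label q'"] by (elim exE conjE)
  have False if nless: "\<forall>X\<in>inf_subsets C. \<not> label (f X) < label (f (shift X))"
  proof -
    have same: "label (f (shift X)) = label (f X)" if "X \<in> inf_subsets C" for X
    proof -
      have "X \<in> inf_subsets B" using that inf_subsets_mono[OF C(1)] by blast
      then have "label (f X) \<le> label (f (shift X))" using B(3) by blast
      moreover have "\<not> label (f X) < label (f (shift X))" using nless that by blast
      ultimately show ?thesis by simp
    qed
    have "\<exists>D\<subseteq>C. infinite D \<and> (\<exists>N. \<forall>X\<in>inf_subsets D. label (f X) = N)"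
      by (rule ramsey_shift_invariant[OF f C(2)]) (rule same)
    then obtain D N where D: "D \<subseteq> C" "infinite D" "\<forall>X\<in>inf_subsets D. label (f X) = N"
      by (elim exE conjE)
    have "\<exists>E\<subseteq>D. infinite E \<and> (\<forall>j\<in>{..N}. \<forall>X\<in>inf_subsets E.
        rank_at (f X) j \<le> rank_at (f (shift X)) j \<and> guess (f X) j \<le> guess (f (shift X)) j)"
    proof (rule simultaneous_shrinking)
      fix j and A :: "nat set" assume A: "infinite A"
      obtain A1 where A1: "A1 \<subseteq> A" "infinite A1"
        "\<forall>X\<in>inf_subsets A1. rank_at (f X) j \<le> rank_at (f (shift X)) j"
        using ramsey_nondecreasing[OF f A, of "\<lambda>q. rank_at q j"] by (elim exE conjE)
      obtain A2 where A2: "A2 \<subseteq> A1" "infinite A2"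
        "\<forall>X\<in>inf_subsets A2. guess (f X) j \<le> guess (f (shift X)) j"
        using ramsey_nondecreasing[OF f A1(2), of "\<lambda>q. guess q j"] by (elim exE conjE)
      have "inf_subsets A2 \<subseteq> inf_subsets A1" using A2(1) by (rule inf_subsets_mono)
      then show "\<exists>B\<subseteq>A. infinite B \<and> (\<forall>X\<in>inf_subsets B.
          rank_at (f X) j \<le> rank_at (f (shift X)) j \<and> guess (f X) j \<le> guess (f (shift X)) j)"
        using A1 A2 by (intro exI[of _ A2]) auto
    qed (use D(2) in \<open>auto dest!: inf_subsets_mono\<close>)
    then obtain E where E: "E \<subseteq> D" "infinite E" "\<forall>j\<in>{..N}. \<forall>X\<in>inf_subsets E.
        rank_at (f X) j \<le> rank_at (f (shift X)) j \<and> guess (f X) j \<le> guess (f (shift X)) j"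
      by (elim exE conjE)
    define X where "X = enumerate E"
    have X: "X \<in> inf_subsets E" unfolding X_def using E(2) by (rule enumerate_in_inf_subsets)
    have "E \<subseteq> A0" using E(1) D(1) C(1) B(1) by blast
    then have "X \<in> inf_subsets A0" using X inf_subsets_mono by blast
    have "X \<in> inf_subsets D" "shift X \<in> inf_subsets D"
      using X inf_subsets_mono[OF E(1)] shift_in_inf_subsets by blast+
    then have "label (f X) = N" "label (f (shift X)) = N" using D(3) by blast+
    moreover have "columns_le (f X) (f (shift X)) N" using E(3) X by (simp add: columns_le_def)
    ultimately have "dominated (f X) (f (shift X))" by (simp add: dominated_def)
    then show False using bad \<open>X \<in> inf_subsets A0\<close> by blast
  qed
  then show ?thesis using B(1) C by (metis order_trans)
qed

text \<open>After \<open>j\<close> shifts the label is at least \<open>j\<close>, which rules out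
  the other Ramsey alternative.\<close>

lemma labels_unbounded:
  assumes inc: "\<forall>X\<in>inf_subsets B. label (f X) < label (f (shift X))" and A: "A \<subseteq> B" "infinite A"
  shows "\<exists>C\<subseteq>A. infinite C \<and> (\<forall>X\<in>inf_subsets C. j \<le> label (f X))"
proof -
  obtain C where C: "C \<subseteq> A" "infinite C"
    "(\<forall>X\<in>inf_subsets C. j \<le> label (f X)) \<or> (\<forall>X\<in>inf_subsets C. \<not> j \<le> label (f X))"
    using ramsey_consecutive[OF f A(2), of "\<lambda>q _. j \<le> label q"] by (elim exE conjE)
  define X where "X = enumerate C"
  have X: "X \<in> inf_subsets C" unfolding X_def using C(2) by (rule enumerate_in_inf_subsets)
  have "C \<subseteq> B" using C(1) A(1) by blast
  then have XB: "(shift ^^ n) X \<in> inf_subsets B" for n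
    using X inf_subsets_mono funpow_shift_in_inf_subsets by blast
  have "n \<le> label (f ((shift ^^ n) X))" for n
  proof (induction n)
    case (Suc n)
    have "label (f ((shift ^^ n) X)) < label (f (shift ((shift ^^ n) X)))" using inc XB by blast
    then show ?case using Suc.IH by simp
  qed simp
  then have "j \<le> label (f ((shift ^^ j) X))" .
  moreover have "(shift ^^ j) X \<in> inf_subsets C" using X by (rule funpow_shift_in_inf_subsets)
  ultimately show ?thesis using C by blast
qed

text \<open>What stage \<open>j\<close> secures: column \<open>j\<close> is within the label, no
  column up to \<open>j\<close> decreases, and the guess there has its final value.\<close>

definition settled :: "nat \<Rightarrow> nat set \<Rightarrow> bool" where
  "settled j B \<longleftrightarrow> (\<exists>v. \<forall>X\<in>inf_subsets B. j \<le> label (f X) \<and>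
     columns_le (f X) (f (shift X)) j \<and> guess (f X) j = v)"

text \<open>Once the columns up to \<open>j\<close> do not decrease, badness forbids a rise at
  \<open>j\<close>. The guess is therefore shift-invariant and can be made constant.\<close>

lemma ex_settled:
  assumes inc: "\<forall>X\<in>inf_subsets B. label (f X) < label (f (shift X))"
    and A: "A \<subseteq> B" "A \<subseteq> A0" "infinite A" and prev: "\<And>i. j = Suc i \<Longrightarrow> settled i A"
  shows "\<exists>C\<subseteq>A. infinite C \<and> settled j C"
proof -
  obtain A1 where A1: "A1 \<subseteq> A" "infinite A1" "\<forall>X\<in>inf_subsets A1. j \<le> label (f X)"
    using labels_unbounded[OF inc A(1,3), of j] by (elim exE conjE)
  obtain A2 where A2: "A2 \<subseteq> A1" "infinite A2"
    "\<forall>X\<in>inf_subsets A2. rank_at (f X) j \<le> rank_at (f (shift X)) j"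
    using ramsey_nondecreasing[OF f A1(2), of "\<lambda>q. rank_at q j"] by (elim exE conjE)
  obtain A3 where A3: "A3 \<subseteq> A2" "infinite A3"
    "\<forall>X\<in>inf_subsets A3. guess (f X) j \<le> guess (f (shift X)) j"
    using ramsey_nondecreasing[OF f A2(2), of "\<lambda>q. guess q j"] by (elim exE conjE)
  have lab: "j \<le> label (f X)" and cols: "columns_le (f X) (f (shift X)) j"
    and gs: "guess (f (shift X)) j = guess (f X) j" if X: "X \<in> inf_subsets A3" for X
  proof -
    have XA: "X \<in> inf_subsets A2" "X \<in> inf_subsets A1" "X \<in> inf_subsets A" "X \<in> inf_subsets A0"
      using X A3(1) A2(1) A1(1) A(2) inf_subsets_mono by blast+
    show lab: "j \<le> label (f X)" using XA A1(3) by blast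
    have jth: "rank_at (f X) j \<le> rank_at (f (shift X)) j" "guess (f X) j \<le> guess (f (shift X)) j"
      using XA A2(3) A3(3) X by blast+
    show cols: "columns_le (f X) (f (shift X)) j"
    proof (cases j)
      case 0
      then show ?thesis using jth by (simp add: columns_le_def)
    next
      case (Suc i)
      then have "columns_le (f X) (f (shift X)) i" using prev XA(3) unfolding settled_def by blast
      then show ?thesis using jth Suc unfolding columns_le_def by (auto simp: le_Suc_eq)
    qed
    have "label (f X) < label (f (shift X))" using inc XA(3) A(1) inf_subsets_mono by blast
    then have "\<not> rises (f X) (f (shift X)) j"
      using bad[OF XA(4)] lab cols unfolding dominated_def by auto
    then show "guess (f (shift X)) j = guess (f X) j" using jth(2) by (simp add: rises_def)
  qed
  have "\<exists>C\<subseteq>A3. infinite C \<and> (\<exists>v. \<forall>X\<in>inf_subsets C. guess (f X) j = v)"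
    by (rule ramsey_shift_invariant[OF f A3(2)]) (rule gs)
  then obtain C v where C: "C \<subseteq> A3" "infinite C" "\<forall>X\<in>inf_subsets C. guess (f X) j = v"
    by (elim exE conjE)
  have "inf_subsets C \<subseteq> inf_subsets A3" using C(1) by (rule inf_subsets_mono)
  then have "settled j C" using C(3) lab cols unfolding settled_def by blast
  then show ?thesis using C A3(1) A2(1) A1(1) by (meson order_trans)
qed

text \<open>The settled guesses form \<open>y\<close>. Along a branch \<open>z\<close> the ranks
  would have to grow without bound, by legality, and yet never exceed the rank at the root.\<close>

lemma no_branches: "\<exists>y. \<forall>z. ((x, y), z) \<notin> F"
proof -
  obtain B where B: "B \<subseteq> A0" "infinite B"
    and inc: "\<forall>X\<in>inf_subsets B. label (f X) < label (f (shift X))"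
    using labels_increasing by (elim exE conjE)
  have "\<exists>C. (\<forall>n. infinite (C n) \<and> C n \<subseteq> B \<and> settled n (C n)) \<and> (\<forall>m n. m \<le> n \<longrightarrow> C n \<subseteq> C m)"
    by (rule decreasing_sequence[OF _ B(2)], rule ex_settled[OF inc]) (use B(1) in auto)
  then obtain C where "\<forall>n. infinite (C n) \<and> C n \<subseteq> B \<and> settled n (C n)"
    and Cdec: "\<forall>m n. m \<le> n \<longrightarrow> C n \<subseteq> C m"
    by (elim exE conjE)
  then have C: "infinite (C n)" "C n \<subseteq> A0" "C n \<subseteq> B" "settled n (C n)" for n
    using B(1) by (meson order_trans)+
  have "\<forall>j. \<exists>v. \<forall>X\<in>inf_subsets (C j). j \<le> label (f X) \<and>
     columns_le (f X) (f (shift X)) j \<and> guess (f X) j = v"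
    using C(4) unfolding settled_def by blast
  from choice[OF this] obtain y where y: "\<forall>j. \<forall>X\<in>inf_subsets (C j). j \<le> label (f X) \<and>
     columns_le (f X) (f (shift X)) j \<and> guess (f X) j = y j"
    by (elim exE)
  have False if z: "((x, y), z) \<in> F" for z
  proof -
    define i where "i m = list_encode (rev (map z [0..<m]))" for m
    have iSuc: "i (Suc m) = Suc (prod_encode (z m, i m))" for m by (simp add: i_def)
    have parent: "parent (i (Suc m)) = i m" for m by (simp add: iSuc parent_def)
    have "i m < i (Suc m)" for m
      unfolding iSuc less_Suc_eq_le by (rule le_prod_encode_2)
    then have imono: "strict_mono i" by (simp add: strict_mono_Suc_iff)
    then have ige: "m \<le> i m" for m by (rule strict_mono_imp_increasing)
    \<comment> \<open>The index \<open>i (Suc n)\<close> is chosen because the \<open>n\<close>-th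
      shift of \<open>X\<close> is where column \<open>i (Suc n)\<close> is compared with its parent
      \<open>i n\<close>.\<close>
    have "\<exists>X. strict_mono X \<and> (\<forall>n. (shift ^^ n) X \<in> inf_subsets (C (i (Suc n))))"
    proof (rule diagonal_sequence)
      show "infinite (C (i (Suc n)))" for n by (rule C(1))
      show "C (i (Suc n)) \<subseteq> C (i (Suc m))" if "m \<le> n" for m n
        using Cdec that imono by (simp add: strict_mono_less_eq)
    qed
    then obtain X where X: "\<forall>n. (shift ^^ n) X \<in> inf_subsets (C (i (Suc n)))"
      by (elim exE conjE)
    define X' where "X' m = (shift ^^ m) X" for m
    have shift_X': "shift (X' m) = X' (Suc m)" for m by (simp add: X'_def)
    have XC: "X' m \<in> inf_subsets (C j)" if "j \<le> i (Suc m)" for m j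
      using X Cdec that inf_subsets_mono unfolding X'_def by blast
    have XA: "X' m \<in> inf_subsets A0" "X' m \<in> inf_subsets B" for m
      using XC[of 0 m] C(2,3) inf_subsets_mono by blast+
    have step: "rank_at (f (X' (Suc m))) (i (Suc m)) \<le> rank_at (f (X' m)) (i m)" for m
    proof -
      have "i (Suc m) \<le> label (f (X' m))" "columns_le (f (X' m)) (f (X' (Suc m))) (i (Suc m))"
        using y[rule_format, OF XC[of "i (Suc m)" m, OF order_refl]] by (simp_all add: shift_X')
      moreover have "label (f (X' m)) < label (f (X' (Suc m)))" using inc XA(2) shift_X' by metis
      moreover have "\<not> dominated (f (X' m)) (f (X' (Suc m)))" using bad[OF XA(1)] shift_X' by metis
      ultimately have "\<not> rises (f (X' m)) (f (X' (Suc m))) (i (Suc m))"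
        unfolding dominated_def by auto
      moreover have "0 < i (Suc m)" by (simp add: iSuc)
      ultimately show ?thesis by (simp add: rises_def parent not_less)
    qed
    have le: "rank_at (f (X' m)) (i m) \<le> rank_at (f (X' 0)) (i 0)" for m
      by (induction m) (use step order_trans in auto)
    \<comment> \<open>The first \<open>m\<close> guesses agree with \<open>y\<close>, since columns
      \<open>j < m\<close> are settled at this shift; so the code of the first \<open>m\<close>
      entries of \<open>z\<close> is a node, and legality applies.\<close>
    have "m \<le> rank_at (f (X' m)) (i m)" for m
    proof -
      have "guess (f (X' m)) j = y j" if "j < m" for j
      proof -
        have "j \<le> i (Suc m)" using that ige[of "Suc m"] by simp
        then show ?thesis using y XC by blast
      qed
      then have "node F x (guess (f (X' m))) (list_decode (i m))"
        using node_prefix[OF z, of m] node_cong[of "rev (map z [0..<m])" x x "guess (f (X' m))" y F]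
        by (simp add: i_def)
      moreover have "i m \<le> label (f (X' m))"
      proof -
        have "i m \<le> i (Suc m)" using imono by (simp add: strict_mono_less_eq)
        then show ?thesis using y XC by blast
      qed
      ultimately show ?thesis using legal[OF XA(1)[of m]] unfolding legal_def by (auto simp: i_def)
    qed
    from this[of "Suc (rank_at (f (X' 0)) (i 0))"] le show False by (meson Suc_n_not_le_n order_trans)
  qed
  then show ?thesis by blast
qed

end

text \<open>Since illegal codes lie above everything, a bad array has legal values at all shifts.
  Every member of \<open>inf_subsets {1..}\<close> is a shift, namely of itself with 0 put in
  front.\<close>

lemma bqo_node_order:
  assumes F: "\<And>y. \<exists>z. ((x, y), z) \<in> F"
  shows "bqo (node_order F x)"
proof (rule ccontr)
  assume "\<not> bqo (node_order F x)"
  then obtain f where f: "locally_constant f"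
    and bad: "\<And>X. strict_mono X \<Longrightarrow> \<not> node_order F x (f X) (f (shift X))"
    using quasi_order_node_order unfolding bqo_iff_locally_constant by blast
  have legal: "legal F x (f X)" if X: "X \<in> inf_subsets {1..}" for X
  proof -
    define X' where "X' = case_nat 0 X"
    have "strict_mono X" "range X \<subseteq> {1..}" using X by (auto simp: inf_subsets_def)
    then have "1 \<le> X 0" by (meson atLeast_iff rangeI subsetD)
    then have "strict_mono X'"
      using \<open>strict_mono X\<close> by (auto simp: X'_def strict_mono_Suc_iff split: nat.split)
    moreover have "shift X' = X" by (simp add: X'_def shift_def)
    ultimately show ?thesis using bad[of X'] unfolding node_order_def by metis
  qed
  interpret legal_array F x f "{1..}"
  proof
    show "infinite {1::nat..}" by (rule infinite_Ici)
    show "\<not> dominated (f X) (f (shift X))" if "X \<in> inf_subsets {1..}" for X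
      using bad[of X] legal[OF that] that unfolding node_order_def inf_subsets_def by blast
  qed (use f legal in auto)
  show False using no_branches F by blast
qed

theorem theorem4p2:
  shows "Pi12_complete BQO"
  unfolding Pi12_complete_def
proof (intro conjI allI impI)
  show "Pi12 BQO" by (rule Pi12_BQO)
  fix P :: "baire set" assume "Pi12 P"
  then obtain B :: "(baire \<times> baire) set" where B: "Pi11 B" "- P = fst ` B"
    unfolding Pi12_def Sigma12_def by (elim exE conjE)
  then obtain F :: "((baire \<times> baire) \<times> baire) set" where F: "closed F" "- B = fst ` F"
    unfolding Pi11_def Sigma11_def by (elim exE conjE)
  \<comment> \<open>Together with \<open>PB\<close> this says that \<open>x \<in> P\<close> holds
    exactly when for every \<open>y\<close> some \<open>z\<close> has
    \<open>((x, y), z) \<in> F\<close>, the dichotomy settled by \<open>bqo_node_order\<close> and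
    \<open>not_bqo_node_order\<close>.\<close>
  have BF: "(x, y) \<in> B \<longleftrightarrow> (\<forall>z. ((x, y), z) \<notin> F)" for x y
  proof -
    have "(x, y) \<in> fst ` F \<longleftrightarrow> (\<exists>z. ((x, y), z) \<in> F)" by force
    then show ?thesis using F(2) by blast
  qed
  have PB: "x \<notin> P \<longleftrightarrow> (\<exists>y. (x, y) \<in> B)" for x
  proof -
    have "x \<in> fst ` B \<longleftrightarrow> (\<exists>y. (x, y) \<in> B)" by force
    then show ?thesis using B(2) by blast
  qed
  have "x \<in> P \<longleftrightarrow> node_code F x \<in> BQO" for x
  proof
    assume "x \<in> P"
    then have "\<exists>z. ((x, y), z) \<in> F" for y using PB BF by blast
    then show "node_code F x \<in> BQO" using bqo_node_order by (simp add: BQO_def coded_rel_node_code)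
  next
    assume bqo: "node_code F x \<in> BQO"
    show "x \<in> P"
    proof (rule ccontr)
      assume "x \<notin> P"
      then obtain y where "\<And>z. ((x, y), z) \<notin> F" using PB BF by blast
      then have "\<not> bqo (node_order F x)" by (rule not_bqo_node_order[OF F(1)])
      then show False using bqo by (simp add: BQO_def coded_rel_node_code)
    qed
  qed
  then show "\<exists>f :: baire \<Rightarrow> cantor. continuous_on UNIV f \<and> (\<forall>x. x \<in> P \<longleftrightarrow> f x \<in> BQO)"
    using continuous_node_code by blast
qed

end
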